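(* Consider the equation $w_xE_x+w_yE_y+E(w_{xx}+w_{yy})=-1$ with $w=w(x,y)$ and $E=E(x,y)$ both dependent variables, and a nonclassical generator $\mathcal U=\xi\,\partial_x+\partial_y+\phi\,\partial_w+\psi\,\partial_E$ of this equation with $\xi=A(x,y)$ and $\phi=G(x,y,w)$. Let $\alpha$ be a function of one variable and let $g=g(y,w)$, with $g_w\neq 0$, be a solution of $$g_y=y+\alpha(g).$$ If $A\equiv 0$ and $G=-g_y/g_w$, then the nonclassical generator is $$\mathcal U=\partial_y-\frac{g_y}{g_w}\,\partial_w+E\left(\frac{g_y}{g_w}\right)_{\!w}\partial_E .$$
   Context: All functions are assumed real analytic on open domains, and $E\neq 0$. Put $F=w_xE_x+w_yE_y+E(w_{xx}+w_{yy})+1$ on the second-order jet space with independent variables $x,y$ and dependent variables $w,E$. For a vector field $\mathcal U=\xi\,\partial_x+\partial_y+\phi\,\partial_w+\psi\,\partial_E$ with $\xi,\phi,\psi$ functions of $(x,y,w,E)$ (the coefficient of $\partial_y$ is normalized to $1$), put $\phi_1=\xi w_x+w_y-\phi$ and $\phi_2=\xi E_x+E_y-\psi$. $\mathcal U$ is called a nonclassical generator (generator of a nonclassical equivalence transformation, or conditional symmetry) of the equation $F=0$ if $\mathrm{pr}^{(2)}\mathcal U(F)=0$, $\mathrm{pr}^{(1)}\mathcal U(\phi_1)=0$ and $\mathrm{pr}^{(1)}\mathcal U(\phi_2)=0$ at all jet points where $F=0$, $\phi_1=\phi_2=0$, and the total derivatives of $\phi_1,\phi_2$ with respect to $x$ and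 $y$ vanish. Here $\mathrm{pr}^{(n)}\mathcal U$ is the usual $n$-th prolongation ($x,y$ independent, $w,E$ dependent). A statement that "the nonclassical generator" with prescribed $\xi$ and $\phi$ is a given vector field means that this vector field is a nonclassical generator and is the one with those $\xi,\phi$. In expressions involving $g$, the variables $y$ and $w$ are independent, and subscripts denote partial derivatives. *)

theory Defs
  imports "HOL-Analysis.Analysis"
begin

text \<open>Real analyticity in several variables: near every point of the set, the function is the sum
  of a power series, indexed by the multi-indices \<open>k\<close> over the standard basis. The sum is
  unordered, so convergence is absolute.\<close>

definition real_analytic_on :: "('a::euclidean_space \<Rightarrow> real) \<Rightarrow> 'a set \<Rightarrow> bool"
    (infix "real'_analytic'_on" 50) where
  "f real_analytic_on S \<longleftrightarrow>
    (\<forall>p\<in>S. \<exists>(c :: ('a \<Rightarrow> nat) \<Rightarrow> real) r. r > 0 \<and>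
      (\<forall>q\<in>ball p r.
        ((\<lambda>k. c k * (\<Prod>b\<in>Basis. ((q - p) \<bullet> b) ^ k b)) has_sum f q)
          (Basis \<rightarrow>\<^sub>E (UNIV :: nat set))))"

text \<open>The partial derivative in the coordinate direction \<open>b\<close>.\<close>

definition partial :: "'a::euclidean_space \<Rightarrow> ('a \<Rightarrow> real) \<Rightarrow> 'a \<Rightarrow> real" where
  "partial b f p = deriv (\<lambda>t. f (p + t *\<^sub>R b)) 0"

text \<open>Coordinates of the second-order jet space with independent variables \<open>x, y\<close> and dependent
  variables \<open>w, E\<close>. Functions on the first-order jet space, or on the base space of points \<open>(x, y, w, E)\<close>, are
  treated as functions on this space that do not depend on the higher coordinates.\<close>

datatype jet_coord =
    jx | jy | jw | jE
  | jwx | jwy | jEx | jEy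
  | jwxx | jwxy | jwyy | jExx | jExy | jEyy

instance jet_coord :: finite
proof
  have "UNIV = {jx, jy, jw, jE, jwx, jwy, jEx, jEy, jwxx, jwxy, jwyy, jExx, jExy, jEyy}"
    using jet_coord.exhaust by blast
  then show "finite (UNIV :: jet_coord set)"
    by (metis finite.emptyI finite.insertI)
qed

type_synonym base = "real \<times> real \<times> real \<times> real"
type_synonym jet = "real ^ jet_coord"

definition base_point :: "jet \<Rightarrow> base" where
  "base_point p = (p $ jx, p $ jy, p $ jw, p $ jE)"

definition lift :: "(base \<Rightarrow> real) \<Rightarrow> jet \<Rightarrow> real" where
  "lift c p = c (base_point p)"

abbreviation jet_partial :: "jet_coord \<Rightarrow> (jet \<Rightarrow> real) \<Rightarrow> jet \<Rightarrow> real" where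
  "jet_partial i \<equiv> partial (axis i 1)"

text \<open>Total derivatives. The terms with derivatives in second-order coordinates are absent:
  \<open>Dx\<close> and \<open>Dy\<close> are only ever applied to functions of order at most one.\<close>

definition Dx :: "(jet \<Rightarrow> real) \<Rightarrow> jet \<Rightarrow> real" where
  "Dx f p = jet_partial jx f p
    + p $ jwx * jet_partial jw f p + p $ jEx * jet_partial jE f p
    + p $ jwxx * jet_partial jwx f p + p $ jwxy * jet_partial jwy f p
    + p $ jExx * jet_partial jEx f p + p $ jExy * jet_partial jEy f p"

definition Dy :: "(jet \<Rightarrow> real) \<Rightarrow> jet \<Rightarrow> real" where
  "Dy f p = jet_partial jy f p
    + p $ jwy * jet_partial jw f p + p $ jEy * jet_partial jE f p
    + p $ jwxy * jet_partial jwx f p + p $ jwyy * jet_partial jwy f p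
    + p $ jExy * jet_partial jEx f p + p $ jEyy * jet_partial jEy f p"

text \<open>One step of the recursion for the coefficients of the prolongation of
  \<open>\<xi> \<partial>\<^sub>x + \<eta> \<partial>\<^sub>y + \<phi> \<partial>\<^sub>w + \<psi> \<partial>\<^sub>E\<close>: if \<open>c\<close> is the coefficient belonging to the jet
  coordinate \<open>u\<^sub>J\<close>, then the one belonging to \<open>u\<^sub>J\<^sub>k\<close> is
  \<open>D\<^sub>k c - u\<^sub>J\<^sub>x D\<^sub>k \<xi> - u\<^sub>J\<^sub>y D\<^sub>k \<eta>\<close>. Here \<open>D\<close> is \<open>D\<^sub>k\<close>, and \<open>i\<close>, \<open>j\<close> are the coordinates
  \<open>u\<^sub>J\<^sub>x\<close>, \<open>u\<^sub>J\<^sub>y\<close>.\<close>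

definition prolong_step ::
  "((jet \<Rightarrow> real) \<Rightarrow> jet \<Rightarrow> real) \<Rightarrow> (base \<Rightarrow> real) \<Rightarrow> (base \<Rightarrow> real) \<Rightarrow>
    jet_coord \<Rightarrow> jet_coord \<Rightarrow> (jet \<Rightarrow> real) \<Rightarrow> jet \<Rightarrow> real" where
  "prolong_step D \<xi> \<eta> i j c p = D c p - p $ i * D (lift \<xi>) p - p $ j * D (lift \<eta>) p"

definition pr1 ::
  "(base \<Rightarrow> real) \<Rightarrow> (base \<Rightarrow> real) \<Rightarrow> (base \<Rightarrow> real) \<Rightarrow> (base \<Rightarrow> real) \<Rightarrow>
    (jet \<Rightarrow> real) \<Rightarrow> jet \<Rightarrow> real" where
  "pr1 \<xi> \<eta> \<phi> \<psi> f p =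
      lift \<xi> p * jet_partial jx f p
    + lift \<eta> p * jet_partial jy f p
    + lift \<phi> p * jet_partial jw f p
    + lift \<psi> p * jet_partial jE f p
    + prolong_step Dx \<xi> \<eta> jwx jwy (lift \<phi>) p * jet_partial jwx f p
    + prolong_step Dy \<xi> \<eta> jwx jwy (lift \<phi>) p * jet_partial jwy f p
    + prolong_step Dx \<xi> \<eta> jEx jEy (lift \<psi>) p * jet_partial jEx f p
    + prolong_step Dy \<xi> \<eta> jEx jEy (lift \<psi>) p * jet_partial jEy f p"

definition pr2 ::
  "(base \<Rightarrow> real) \<Rightarrow> (base \<Rightarrow> real) \<Rightarrow> (base \<Rightarrow> real) \<Rightarrow> (base \<Rightarrow> real) \<Rightarrow>
    (jet \<Rightarrow> real) \<Rightarrow> jet \<Rightarrow> real" where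
  "pr2 \<xi> \<eta> \<phi> \<psi> f p =
    (let \<phi>x = prolong_step Dx \<xi> \<eta> jwx jwy (lift \<phi>);
         \<phi>y = prolong_step Dy \<xi> \<eta> jwx jwy (lift \<phi>);
         \<psi>x = prolong_step Dx \<xi> \<eta> jEx jEy (lift \<psi>);
         \<psi>y = prolong_step Dy \<xi> \<eta> jEx jEy (lift \<psi>)
     in pr1 \<xi> \<eta> \<phi> \<psi> f p
      + prolong_step Dx \<xi> \<eta> jwxx jwxy \<phi>x p * jet_partial jwxx f p
      + prolong_step Dy \<xi> \<eta> jwxx jwxy \<phi>x p * jet_partial jwxy f p
      + prolong_step Dy \<xi> \<eta> jwxy jwyy \<phi>y p * jet_partial jwyy f p
      + prolong_step Dx \<xi> \<eta> jExx jExy \<psi>x p * jet_partial jExx f p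
      + prolong_step Dy \<xi> \<eta> jExx jExy \<psi>x p * jet_partial jExy f p
      + prolong_step Dy \<xi> \<eta> jExy jEyy \<psi>y p * jet_partial jEyy f p)"

definition equation_F :: "jet \<Rightarrow> real" where
  "equation_F p = p $ jwx * p $ jEx + p $ jwy * p $ jEy + p $ jE * (p $ jwxx + p $ jwyy) + 1"

definition invariant_w :: "(base \<Rightarrow> real) \<Rightarrow> (base \<Rightarrow> real) \<Rightarrow> jet \<Rightarrow> real" where
  "invariant_w \<xi> \<phi> p = lift \<xi> p * p $ jwx + p $ jwy - lift \<phi> p"

definition invariant_E :: "(base \<Rightarrow> real) \<Rightarrow> (base \<Rightarrow> real) \<Rightarrow> jet \<Rightarrow> real" where
  "invariant_E \<xi> \<psi> p = lift \<xi> p * p $ jEx + p $ jEy - lift \<psi> p"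

text \<open>The vector field \<open>\<xi> \<partial>\<^sub>x + \<partial>\<^sub>y + \<phi> \<partial>\<^sub>w + \<psi> \<partial>\<^sub>E\<close>, with analytic coefficients on the open
  set \<open>S\<close> of points \<open>(x, y, w, E)\<close> with \<open>E \<noteq> 0\<close>, is a nonclassical generator of
  \<open>F = 0\<close>. The values of \<open>\<xi>, \<phi>, \<psi>\<close> outside \<open>S\<close> are irrelevant.\<close>

definition nonclassical_generator ::
  "base set \<Rightarrow> (base \<Rightarrow> real) \<Rightarrow> (base \<Rightarrow> real) \<Rightarrow> (base \<Rightarrow> real) \<Rightarrow> bool" where
  "nonclassical_generator S \<xi> \<phi> \<psi> \<longleftrightarrow>
    open S \<and> (\<forall>(x, y, w, E)\<in>S. E \<noteq> 0) \<and>
    \<xi> real_analytic_on S \<and> \<phi> real_analytic_on S \<and> \<psi> real_analytic_on S \<and>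
    (\<forall>p. base_point p \<in> S \<and> equation_F p = 0 \<and>
         invariant_w \<xi> \<phi> p = 0 \<and> invariant_E \<xi> \<psi> p = 0 \<and>
         Dx (invariant_w \<xi> \<phi>) p = 0 \<and> Dy (invariant_w \<xi> \<phi>) p = 0 \<and>
         Dx (invariant_E \<xi> \<psi>) p = 0 \<and> Dy (invariant_E \<xi> \<psi>) p = 0 \<longrightarrow>
         pr2 \<xi> (\<lambda>_. 1) \<phi> \<psi> equation_F p = 0 \<and>
         pr1 \<xi> (\<lambda>_. 1) \<phi> \<psi> (invariant_w \<xi> \<phi>) p = 0 \<and>
         pr1 \<xi> (\<lambda>_. 1) \<phi> \<psi> (invariant_E \<xi> \<psi>) p = 0)"

text \<open>Functions \<open>g (y, w)\<close> of the two variables \<open>y, w\<close>.\<close>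

abbreviation d_y :: "(real \<times> real \<Rightarrow> real) \<Rightarrow> real \<times> real \<Rightarrow> real" where
  "d_y \<equiv> partial (1, 0)"

abbreviation d_w :: "(real \<times> real \<Rightarrow> real) \<Rightarrow> real \<times> real \<Rightarrow> real" where
  "d_w \<equiv> partial (0, 1)"

end

theory Submission
  imports Defs
begin

text \<open>With \<open>\<xi> = 0\<close> and \<open>\<phi> = f(y, w)\<close> the side conditions express \<open>w\<^sub>y\<close>, \<open>E\<^sub>y\<close>, their derivatives and
  \<open>w\<^sub>x\<^sub>x\<close> through \<open>x, y, w, E, w\<^sub>x, E\<^sub>x\<close>, which remain free. The invariance condition becomes a
  polynomial in \<open>w\<^sub>x, E\<^sub>x\<close>; its coefficients give \<open>\<psi>\<^sub>E = \<psi> / E\<close>, \<open>\<psi>\<^sub>w = - E f\<^sub>w\<^sub>w\<close>, \<open>\<psi>\<^sub>x = 0\<close> and one more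
  equation. By the first one \<open>\<psi>\<close> is locally linear in \<open>E\<close>, so that the last one splits into the part
  of degree \<open>0\<close> in \<open>E\<close>, which is \<open>\<psi> = - E f\<^sub>w\<close>, and the part of degree \<open>1\<close>, which is then
  \<open>f\<^sub>y\<^sub>y + f f\<^sub>y\<^sub>w = f\<^sub>y f\<^sub>w\<close>; the equation for \<open>g\<close> implies the latter. That the coefficients of the
  generator are analytic needs the closure of real analytic functions under products, quotients and
  partial derivatives.\<close>

section \<open>Power series expansions over arbitrary index sets\<close>

text \<open>Apart from its constant term 1, \<open>equation_F\<close> is homogeneous of degree one
  in \<open>E, E_x, E_y\<close>; that constant alone creates the part of degree 0 that determines
  \<open>\<psi>\<close>. As \<open>S\<close> is an arbitrary open set, scaling is available only
  locally: \<open>\<psi>\<close> is compared at \<open>E\<close> and at \<open>r * E\<close> for one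
  \<open>r > 1\<close> that keeps the segment between them in \<open>S\<close> and hence away from
  \<open>E = 0\<close>. The invariance condition is tested at jet points, not along solutions, so
  arbitrary values of \<open>w_x, E_x\<close> can be completed to an admissible jet by solving the
  side conditions; \<open>E \<noteq> 0\<close> is what allows solving for \<open>w_xx\<close>. The
  conditions on the two invariants hold automatically, so \<open>\<psi>\<close> is restricted only
  through \<open>equation_F\<close>. On the analytic side every expansion carries a radius at which
  its coefficients are absolutely summable. The resulting weighted l1 norm is multiplicative, which
  turns reciprocals into a geometric series, and the gap between two radii pays for
  derivatives.\<close>

definition monomial :: "('a::euclidean_space \<Rightarrow> nat) \<Rightarrow> 'a \<Rightarrow> real" where
  "monomial k v = (\<Prod>b\<in>Basis. (v \<bullet> b) ^ k b)"

definition mdeg :: "('a::euclidean_space \<Rightarrow> nat) \<Rightarrow> nat" where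
  "mdeg k = (\<Sum>b\<in>Basis. k b)"

text \<open>Closed balls of the maximum norm suit multi-indexed series: on them a monomial of degree
  \<open>n\<close> is at most \<open>\<rho> ^ n\<close> in absolute value, with equality at a
  corner.\<close>

definition cube :: "'a::euclidean_space \<Rightarrow> real \<Rightarrow> 'a set" where
  "cube p \<rho> = {q. \<forall>b\<in>Basis. \<bar>(q - p) \<bullet> b\<bar> \<le> \<rho>}"

abbreviation multi_indices :: "('a::euclidean_space \<Rightarrow> nat) set" where
  "multi_indices \<equiv> Basis \<rightarrow>\<^sub>E UNIV"

text \<open>The index set is arbitrary and several indices may share an exponent: products, derivatives and
  geometric series then need no rearrangement of coefficients. Sorting by exponent is done once and
  for all in \<open>has_expansion_regroup\<close>.\<close>

definition has_expansion ::
  "'a::euclidean_space \<Rightarrow> real \<Rightarrow> 'i set \<Rightarrow> ('i \<Rightarrow> real) \<Rightarrow> ('i \<Rightarrow> 'a \<Rightarrow> nat) \<Rightarrow> ('a \<Rightarrow> real) \<Rightarrow> bool"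
  where
  "has_expansion p \<rho> A c \<kappa> f \<longleftrightarrow>
    (\<lambda>a. \<bar>c a\<bar> * \<rho> ^ mdeg (\<kappa> a)) summable_on A \<and>
    (\<forall>q\<in>cube p \<rho>. ((\<lambda>a. c a * monomial (\<kappa> a) (q - p)) has_sum f q) A)"

text \<open>A weighted l1 norm of the coefficient family. It bounds the function on the whole cube
  and is multiplicative under products.\<close>

definition majorant :: "real \<Rightarrow> 'i set \<Rightarrow> ('i \<Rightarrow> real) \<Rightarrow> ('i \<Rightarrow> 'a::euclidean_space \<Rightarrow> nat) \<Rightarrow> real"
  where "majorant \<rho> A c \<kappa> = (\<Sum>\<^sub>\<infinity>a\<in>A. \<bar>c a\<bar> * \<rho> ^ mdeg (\<kappa> a))"

section \<open>Cubes, monomials and sorting by exponent\<close>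

lemma has_expansionD:
  assumes "has_expansion p \<rho> A c \<kappa> f" "q \<in> cube p \<rho>"
  shows "((\<lambda>a. c a * monomial (\<kappa> a) (q - p)) has_sum f q) A"
  using assms by (simp add: has_expansion_def)

lemma cube_mono: "\<rho> \<le> \<sigma> \<Longrightarrow> cube p \<rho> \<subseteq> cube p \<sigma>"
  by (force simp: cube_def)

lemma centre_in_cube: "\<rho> \<ge> 0 \<Longrightarrow> p \<in> cube p \<rho>"
  by (simp add: cube_def)

lemma ball_subset_cube: "ball p \<rho> \<subseteq> cube p \<rho>"
proof
  fix q assume "q \<in> ball p \<rho>"
  then have "norm (q - p) \<le> \<rho>"
    by (simp add: dist_norm norm_minus_commute)
  then show "q \<in> cube p \<rho>"
    unfolding cube_def using Basis_le_norm order_trans by blast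
qed

text \<open>The l1 bound on the norm costs the factor \<open>DIM('a)\<close>; the further factor 2
  keeps the closed cube inside the open ball.\<close>

lemma cube_subset_ball:
  fixes p :: "'a::euclidean_space"
  assumes "r > 0"
  shows "cube p (r / (2 * DIM('a))) \<subseteq> ball p r"
proof
  fix q assume q: "q \<in> cube p (r / (2 * DIM('a)))"
  have "norm (q - p) \<le> (\<Sum>b\<in>Basis. \<bar>(q - p) \<bullet> b\<bar>)"
    by (rule norm_le_l1)
  also have "\<dots> \<le> (\<Sum>b\<in>(Basis::'a set). r / (2 * DIM('a)))"
    using q by (intro sum_mono) (auto simp: cube_def)
  also have "\<dots> = r / 2"
    by simp
  finally show "q \<in> ball p r"
    using assms by (simp add: dist_norm norm_minus_commute)
qed

lemma monomial_restrict [simp]: "monomial (restrict k Basis) = monomial k"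
  by (simp add: monomial_def fun_eq_iff)

lemma mdeg_restrict [simp]: "mdeg (restrict k Basis) = mdeg k"
  by (simp add: mdeg_def)

lemma monomial_add: "monomial (\<lambda>b. k b + l b) v = monomial k v * monomial l v"
  by (simp add: monomial_def power_add prod.distrib)

lemma mdeg_add: "mdeg (\<lambda>b. k b + l b) = mdeg k + mdeg l"
  by (simp add: mdeg_def sum.distrib)

lemma monomial_diag: "monomial k (\<Sum>b\<in>Basis. t *\<^sub>R b) = t ^ mdeg k"
proof -
  have "monomial k (\<Sum>b\<in>Basis. t *\<^sub>R b) = (\<Prod>b\<in>Basis. t ^ k b)"
    unfolding monomial_def by (intro prod.cong) auto
  then show ?thesis by (simp add: mdeg_def power_sum)
qed

lemma abs_monomial_le:
  assumes "q \<in> cube p \<rho>"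
  shows "\<bar>monomial k (q - p)\<bar> \<le> \<rho> ^ mdeg k"
proof -
  have "\<bar>monomial k (q - p)\<bar> = (\<Prod>b\<in>Basis. \<bar>(q - p) \<bullet> b\<bar> ^ k b)"
    by (simp add: monomial_def abs_prod power_abs)
  also have "\<dots> \<le> (\<Prod>b\<in>(Basis::'a set). \<rho> ^ k b)"
    using assms by (intro prod_mono) (auto simp: cube_def intro: power_mono)
  finally show ?thesis by (simp add: mdeg_def power_sum)
qed

lemma expansion_abs_summable:
  assumes "(\<lambda>a. \<bar>c a\<bar> * \<rho> ^ mdeg (\<kappa> a)) summable_on A" "q \<in> cube p \<rho>"
  shows "(\<lambda>a. c a * monomial (\<kappa> a) (q - p)) summable_on A"
proof -
  have "(\<lambda>a. norm (c a * monomial (\<kappa> a) (q - p))) summable_on A"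
    using assms(1)
    by (rule summable_on_comparison_test)
      (auto simp: abs_mult intro: mult_left_mono abs_monomial_le[OF assms(2)])
  then show ?thesis
    using summable_on_iff_abs_summable_on_real by blast
qed

text \<open>The sum over \<open>A\<close> is split into the fibres of the exponent map.
  \<open>restrict\<close> normalises exponents outside \<open>Basis\<close>, where monomials do not
  look but \<open>multi_indices\<close> prescribes a value. The bound on the majorant makes it
  possible to regroup every term of a series of functions and still have a summable series.\<close>

lemma has_expansion_regroup:
  assumes f: "has_expansion p \<rho> A c \<kappa> f" and \<rho>: "\<rho> > 0"
  obtains d where "has_expansion p \<rho> multi_indices d (\<lambda>k. k) f"
    and "majorant \<rho> multi_indices d (\<lambda>k. k) \<le> majorant \<rho> A c \<kappa>"
proof -
  define fib where "fib k = {a\<in>A. restrict (\<kappa> a) Basis = k}" for k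
  define d where "d k = (\<Sum>\<^sub>\<infinity>a\<in>fib k. c a)" for k
  define m where "m k = (\<Sum>\<^sub>\<infinity>a\<in>fib k. \<bar>c a\<bar> * \<rho> ^ mdeg (\<kappa> a))" for k
  have bij: "bij_betw snd (Sigma multi_indices fib) A"
    by (rule bij_betw_byWitness[where f' = "\<lambda>a. (restrict (\<kappa> a) Basis, a)"])
      (auto simp: fib_def)
  have sum: "(\<lambda>a. \<bar>c a\<bar> * \<rho> ^ mdeg (\<kappa> a)) summable_on A"
    using f by (simp add: has_expansion_def)
  have deg: "mdeg (\<kappa> a) = mdeg k" and mon: "monomial (\<kappa> a) = monomial k" if "a \<in> fib k" for a k
    using that monomial_restrict[of "\<kappa> a"] mdeg_restrict[of "\<kappa> a"] by (auto simp: fib_def)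
  have sumf: "(\<lambda>a. \<bar>c a\<bar> * \<rho> ^ mdeg (\<kappa> a)) summable_on fib k" for k
    using sum by (rule summable_on_subset) (auto simp: fib_def)
  \<comment> \<open>On a fibre the weight \<open>\<rho> ^ mdeg k\<close> is constant and nonzero, so
    it cancels.\<close>
  have abs_c: "(\<lambda>a. \<bar>c a\<bar>) summable_on fib k" for k
  proof -
    have "(\<lambda>a. \<bar>c a\<bar> * \<rho> ^ mdeg k) summable_on fib k"
      using sumf[of k] by (rule summable_on_cong[THEN iffD1, rotated]) (simp add: deg)
    then show ?thesis using \<rho> by (simp add: summable_on_cmult_left')
  qed
  have sum_c: "(c has_sum d k) (fib k)" for k
    using abs_c[of k] summable_on_iff_abs_summable_on_real[of c "fib k"]
    by (simp add: d_def)
  have m_sum: "(m has_sum majorant \<rho> A c \<kappa>) multi_indices"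
  proof (rule has_sum_SigmaD)
    show "((\<lambda>x. \<bar>c (snd x)\<bar> * \<rho> ^ mdeg (\<kappa> (snd x))) has_sum majorant \<rho> A c \<kappa>) (Sigma multi_indices fib)"
      using has_sum_reindex_bij_betw[OF bij, of "\<lambda>a. \<bar>c a\<bar> * \<rho> ^ mdeg (\<kappa> a)"] sum
      by (simp add: majorant_def)
    show "((\<lambda>y. \<bar>c (snd (k, y))\<bar> * \<rho> ^ mdeg (\<kappa> (snd (k, y)))) has_sum m k) (fib k)" for k
      using sumf[of k] by (simp add: m_def)
  qed
  have d_le: "\<bar>d k\<bar> * \<rho> ^ mdeg k \<le> m k" for k
  proof -
    have "\<bar>d k\<bar> \<le> (\<Sum>\<^sub>\<infinity>a\<in>fib k. \<bar>c a\<bar>)"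
      unfolding d_def using norm_infsum_bound[of c "fib k"] abs_c[of k] by simp
    moreover have "m k = (\<Sum>\<^sub>\<infinity>a\<in>fib k. \<bar>c a\<bar> * \<rho> ^ mdeg k)"
      unfolding m_def by (intro infsum_cong) (simp add: deg)
    ultimately show ?thesis
      using \<rho> by (simp add: infsum_cmult_left' mult_right_mono)
  qed
  have d_sum: "(\<lambda>k. \<bar>d k\<bar> * \<rho> ^ mdeg k) summable_on multi_indices"
    using has_sum_imp_summable[OF m_sum]
    by (rule summable_on_comparison_test) (use d_le \<rho> in auto)
  show thesis
  proof
    show "has_expansion p \<rho> multi_indices d (\<lambda>k. k) f"
      unfolding has_expansion_def
    proof (intro conjI ballI d_sum)
      fix q assume q: "q \<in> cube p \<rho>"
      show "((\<lambda>k. d k * monomial k (q - p)) has_sum f q) multi_indices"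
      proof (rule has_sum_SigmaD)
        show "((\<lambda>x. c (snd x) * monomial (\<kappa> (snd x)) (q - p)) has_sum f q) (Sigma multi_indices fib)"
          using has_sum_reindex_bij_betw[OF bij, of "\<lambda>a. c a * monomial (\<kappa> a) (q - p)"] f q
          by (simp add: has_expansion_def)
        show "((\<lambda>y. c (snd (k, y)) * monomial (\<kappa> (snd (k, y))) (q - p))
            has_sum d k * monomial k (q - p)) (fib k)" for k
          using has_sum_cmult_left[OF sum_c[of k], of "monomial k (q - p)"]
          by (rule has_sum_cong[THEN iffD1, rotated]) (simp add: mon)
      qed
    qed
    show "majorant \<rho> multi_indices d (\<lambda>k. k) \<le> majorant \<rho> A c \<kappa>"
      unfolding majorant_def[of \<rho> multi_indices d]
      using has_sum_infsum[OF d_sum] m_sum by (rule has_sum_mono) (rule d_le)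
  qed
qed

text \<open>An existential cannot range over types, so one index type \<open>'i\<close> serves all
  points; uses of this lemma fix it by an annotation on \<open>A\<close>.\<close>

lemma has_expansion_imp_real_analytic:
  assumes "\<And>p. p \<in> S \<Longrightarrow> \<exists>\<rho>>0. \<exists>A c \<kappa>. has_expansion p \<rho> (A::'i set) c \<kappa> f"
  shows "f real_analytic_on S"
  unfolding real_analytic_on_def
proof
  fix p assume "p \<in> S"
  then obtain \<rho> A c \<kappa> where \<rho>: "\<rho> > 0" and f: "has_expansion p \<rho> (A::'i set) c \<kappa> f"
    using assms by blast
  then obtain d where "has_expansion p \<rho> multi_indices d (\<lambda>k. k) f"
    using has_expansion_regroup by metis
  then have "\<forall>q\<in>ball p \<rho>. ((\<lambda>k. d k * (\<Prod>b\<in>Basis. ((q - p) \<bullet> b) ^ k b)) has_sum f q) multi_indices"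
    using ball_subset_cube by (fastforce simp: has_expansion_def monomial_def)
  then show "\<exists>c r. r > 0 \<and> (\<forall>q\<in>ball p r.
      ((\<lambda>k. c k * (\<Prod>b\<in>Basis. ((q - p) \<bullet> b) ^ k b)) has_sum f q) multi_indices)"
    using \<rho> by blast
qed

text \<open>At the corner \<open>p + e\<close> of a cube inside the ball of convergence each
  monomial equals \<open>\<rho> ^ mdeg k\<close>. Convergence there is unordered, hence absolute,
  and this one point yields the summability for the whole cube.\<close>

lemma real_analytic_imp_has_expansion:
  fixes f :: "'a::euclidean_space \<Rightarrow> real"
  assumes "f real_analytic_on S" "p \<in> S"
  obtains \<rho> c where "\<rho> > 0" "has_expansion p \<rho> multi_indices c (\<lambda>k. k) f"
proof -
  from assms obtain c r where r: "r > 0" and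
    f: "\<And>q. q \<in> ball p r \<Longrightarrow> ((\<lambda>k. c k * monomial k (q - p)) has_sum f q) multi_indices"
    unfolding real_analytic_on_def monomial_def by meson
  define \<rho> where "\<rho> = r / (2 * DIM('a))"
  have \<rho>: "\<rho> > 0" using r by (simp add: \<rho>_def)
  have sub: "cube p \<rho> \<subseteq> ball p r"
    unfolding \<rho>_def using r by (rule cube_subset_ball)
  define e :: 'a where "e = (\<Sum>b\<in>Basis. \<rho> *\<^sub>R b)"
  have "p + e \<in> cube p \<rho>"
    using \<rho> by (auto simp: cube_def e_def)
  then have "p + e \<in> ball p r"
    using sub by blast
  from f[OF this] have "((\<lambda>k. c k * monomial k e) has_sum f (p + e)) multi_indices"
    by simp
  then have "(\<lambda>k. c k * \<rho> ^ mdeg k) summable_on multi_indices"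
    by (simp add: e_def monomial_diag has_sum_imp_summable)
  then have "(\<lambda>k. \<bar>c k\<bar> * \<rho> ^ mdeg k) summable_on multi_indices"
    using \<rho> summable_on_iff_abs_summable_on_real[of "\<lambda>k. c k * \<rho> ^ mdeg k"]
    by (simp add: abs_mult)
  then have "has_expansion p \<rho> multi_indices c (\<lambda>k. k) f"
    using f sub by (auto simp: has_expansion_def)
  then show thesis using \<rho> that by blast
qed

text \<open>The absolute sum over pairs factors into the two majorants. This gives both the
  summability over \<open>A \<times> B\<close> and the exact product formula.\<close>

lemma has_expansion_mult:
  assumes f: "has_expansion p \<rho> A c \<kappa> f" and g: "has_expansion p \<rho> B d l g" and \<rho>: "\<rho> > 0"
  shows "has_expansion p \<rho> (A \<times> B) (\<lambda>(a, b). c a * d b) (\<lambda>(a, b) i. \<kappa> a i + l b i) (\<lambda>q. f q * g q)"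
    and "majorant \<rho> (A \<times> B) (\<lambda>(a, b). c a * d b) (\<lambda>(a, b) i. \<kappa> a i + l b i) =
      majorant \<rho> A c \<kappa> * majorant \<rho> B d l"
proof -
  let ?C = "\<lambda>(a, b). c a * d b" and ?K = "\<lambda>(a, b) i. \<kappa> a i + l b i"
  let ?T = "\<lambda>x. \<bar>?C x\<bar> * \<rho> ^ mdeg (?K x)"
  have hA: "((\<lambda>a. \<bar>c a\<bar> * \<rho> ^ mdeg (\<kappa> a)) has_sum majorant \<rho> A c \<kappa>) A"
    and hB: "((\<lambda>b. \<bar>d b\<bar> * \<rho> ^ mdeg (l b)) has_sum majorant \<rho> B d l) B"
    using f g by (simp_all add: has_expansion_def majorant_def)
  have inner: "((\<lambda>b. ?T (a, b)) has_sum (\<bar>c a\<bar> * \<rho> ^ mdeg (\<kappa> a)) * majorant \<rho> B d l) B" for a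
    using has_sum_cmult_right[OF hB, of "\<bar>c a\<bar> * \<rho> ^ mdeg (\<kappa> a)"]
    by (simp add: mdeg_add power_add abs_mult mult_ac)
  have outer: "((\<lambda>a. (\<bar>c a\<bar> * \<rho> ^ mdeg (\<kappa> a)) * majorant \<rho> B d l) has_sum
      majorant \<rho> A c \<kappa> * majorant \<rho> B d l) A"
    using has_sum_cmult_left[OF hA] .
  have summ: "?T summable_on A \<times> B"
    by (rule summable_on_SigmaI[OF inner has_sum_imp_summable[OF outer]]) (use \<rho> in auto)
  show "majorant \<rho> (A \<times> B) ?C ?K = majorant \<rho> A c \<kappa> * majorant \<rho> B d l"
    unfolding majorant_def[of \<rho> "A \<times> B"]
    by (rule infsumI[OF has_sum_SigmaI[OF inner outer summ]])
  show "has_expansion p \<rho> (A \<times> B) ?C ?K (\<lambda>q. f q * g q)"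
    unfolding has_expansion_def
  proof (intro conjI ballI summ)
    fix q assume q: "q \<in> cube p \<rho>"
    have fq: "((\<lambda>a. c a * monomial (\<kappa> a) (q - p)) has_sum f q) A"
      and gq: "((\<lambda>b. d b * monomial (l b) (q - p)) has_sum g q) B"
      using f g q by (simp_all add: has_expansion_def)
    show "((\<lambda>x. ?C x * monomial (?K x) (q - p)) has_sum f q * g q) (A \<times> B)"
    proof (rule has_sum_SigmaI)
      show "((\<lambda>b. ?C (a, b) * monomial (?K (a, b)) (q - p)) has_sum
          (c a * monomial (\<kappa> a) (q - p)) * g q) B" for a
        using has_sum_cmult_right[OF gq, of "c a * monomial (\<kappa> a) (q - p)"]
        by (simp add: monomial_add mult_ac)
      show "((\<lambda>a. (c a * monomial (\<kappa> a) (q - p)) * g q) has_sum f q * g q) A"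
        using has_sum_cmult_left[OF fq] .
      show "(\<lambda>x. ?C x * monomial (?K x) (q - p)) summable_on A \<times> B"
        by (rule expansion_abs_summable[OF summ q])
    qed
  qed
qed

section \<open>Elementary expansions, series and reciprocals\<close>

lemma has_expansion_const: "has_expansion p \<rho> {()} (\<lambda>_. C) (\<lambda>_ _. 0) (\<lambda>_. C)"
  using has_sum_finite[of "{()}" "\<lambda>_. C"]
  by (simp add: has_expansion_def monomial_def mdeg_def)

text \<open>Around \<open>p\<close> a coordinate is \<open>(q - p) \<bullet> b\<close> plus the
  constant \<open>p \<bullet> b\<close>; the index \<open>True\<close> stands for the linear term,
  \<open>False\<close> for the constant.\<close>

lemma has_expansion_coord:
  fixes p :: "'a::euclidean_space"
  assumes "b \<in> Basis"
  shows "has_expansion p \<rho> UNIV (\<lambda>i. if i then 1 else p \<bullet> b)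
    (\<lambda>i b'. if i \<and> b' = b then 1 else 0) (\<lambda>q. q \<bullet> b)"
  unfolding has_expansion_def
proof (intro conjI ballI)
  fix q :: 'a
  let ?t = "\<lambda>i. (if i then 1 else p \<bullet> b) * monomial (\<lambda>b'. if i \<and> b' = b then 1 else 0) (q - p)"
  have "(\<Prod>b'\<in>Basis. ((q - p) \<bullet> b') ^ (if b' = b then 1 else 0)) =
      (\<Prod>b'\<in>Basis. if b' = b then (q - p) \<bullet> b' else 1)"
    by (intro prod.cong) auto
  then have "sum ?t UNIV = q \<bullet> b"
    using assms by (simp add: monomial_def UNIV_bool inner_diff_left)
  then show "(?t has_sum q \<bullet> b) UNIV"
    using has_sum_finite[of UNIV ?t] by simp
qed (simp add: summable_on_finite)

text \<open>The Weierstrass test: a summable bound on the majorants makes the double family over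
  \<open>(n, k)\<close> absolutely summable, and summing over \<open>k\<close> first returns the
  given functions.\<close>

lemma has_expansion_suminf:
  fixes p :: "'a::euclidean_space"
  assumes f: "\<And>n. has_expansion p \<rho> multi_indices (c n) (\<lambda>k. k) (f n)"
    and M: "\<And>n. majorant \<rho> multi_indices (c n) (\<lambda>k. k) \<le> M n" "M summable_on (UNIV :: nat set)"
    and g: "\<And>q. q \<in> cube p \<rho> \<Longrightarrow> ((\<lambda>n. f n q) has_sum g q) UNIV"
    and \<rho>: "\<rho> > 0"
  shows "has_expansion p \<rho> (UNIV \<times> multi_indices) (\<lambda>(n, k). c n k) snd g"
proof -
  let ?K = "multi_indices :: ('a \<Rightarrow> nat) set"
  have inner: "((\<lambda>k. \<bar>c n k\<bar> * \<rho> ^ mdeg k) has_sum majorant \<rho> ?K (c n) (\<lambda>k. k)) ?K" for n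
    using f[of n] by (simp add: has_expansion_def majorant_def)
  have nonneg: "majorant \<rho> ?K (c n) (\<lambda>k. k) \<ge> 0" for n
    unfolding majorant_def using \<rho> by (intro infsum_nonneg) auto
  have "(\<lambda>n. majorant \<rho> ?K (c n) (\<lambda>k. k)) summable_on UNIV"
    using M(2) by (rule summable_on_comparison_test) (use M(1) nonneg in auto)
  then have summ: "(\<lambda>x. \<bar>(\<lambda>(n, k). c n k) x\<bar> * \<rho> ^ mdeg (snd x)) summable_on UNIV \<times> ?K"
    by (intro summable_on_SigmaI[where g = "\<lambda>n. majorant \<rho> ?K (c n) (\<lambda>k. k)"])
      (use inner \<rho> in auto)
  show ?thesis
    unfolding has_expansion_def
  proof (intro conjI ballI summ)
    fix q assume q: "q \<in> cube p \<rho>"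
    show "((\<lambda>x. (\<lambda>(n, k). c n k) x * monomial (snd x) (q - p)) has_sum g q) (UNIV \<times> ?K)"
    proof (rule has_sum_SigmaI[OF _ g[OF q] expansion_abs_summable[OF summ q]])
      show "((\<lambda>k. (\<lambda>(n, k). c n k) (n, k) * monomial (snd (n, k)) (q - p)) has_sum f n q) ?K" for n
        using f[of n] q by (simp add: has_expansion_def)
    qed
  qed
qed

text \<open>Regrouping after each factor keeps the index set at \<open>multi_indices\<close>; with
  bare products the index type would grow with \<open>n\<close>.\<close>

lemma has_expansion_power:
  fixes p :: "'a::euclidean_space"
  assumes u: "has_expansion p \<rho> A c \<kappa> u" and \<rho>: "\<rho> > 0" and M: "majorant \<rho> A c \<kappa> \<le> M"
  shows "\<exists>d. has_expansion p \<rho> multi_indices d (\<lambda>k. k) (\<lambda>q. u q ^ n) \<and>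
    majorant \<rho> multi_indices d (\<lambda>k. k) \<le> M ^ n"
proof (induction n)
  case 0
  have "majorant \<rho> {()} (\<lambda>_. 1) (\<lambda>_ _::'a. 0) = 1"
    by (simp add: majorant_def mdeg_def)
  moreover obtain d where "has_expansion p \<rho> multi_indices d (\<lambda>k. k) (\<lambda>_. 1)"
    "majorant \<rho> multi_indices d (\<lambda>k. k) \<le> majorant \<rho> {()} (\<lambda>_. 1) (\<lambda>_ _::'a. 0)"
    using has_expansion_regroup[OF has_expansion_const[of p \<rho> 1] \<rho>] .
  ultimately show ?case by auto
next
  case (Suc n)
  then obtain d where d: "has_expansion p \<rho> multi_indices d (\<lambda>k. k) (\<lambda>q. u q ^ n)"
    and dM: "majorant \<rho> multi_indices d (\<lambda>k. k) \<le> M ^ n" by blast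
  have nonneg: "majorant \<rho> A c \<kappa> \<ge> 0" "majorant \<rho> multi_indices d (\<lambda>k. k) \<ge> 0"
    unfolding majorant_def using \<rho> by (auto intro!: infsum_nonneg)
  note prod = has_expansion_mult[OF u d \<rho>]
  have "majorant \<rho> A c \<kappa> * majorant \<rho> multi_indices d (\<lambda>k. k) \<le> M * M ^ n"
    using M dM nonneg by (intro mult_mono) auto
  moreover obtain d' where "has_expansion p \<rho> multi_indices d' (\<lambda>k. k) (\<lambda>q. u q * u q ^ n)"
    "majorant \<rho> multi_indices d' (\<lambda>k. k) \<le> majorant \<rho> A c \<kappa> * majorant \<rho> multi_indices d (\<lambda>k. k)"
    using has_expansion_regroup[OF prod(1) \<rho>] unfolding prod(2) .
  ultimately show ?case by (auto intro: order_trans)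
qed

lemma monomial_zero:
  assumes "k \<in> multi_indices" "k \<noteq> restrict (\<lambda>_. 0) Basis"
  shows "monomial k 0 = 0" and "mdeg k \<ge> 1"
proof -
  obtain b where b: "b \<in> Basis" "k b \<noteq> 0"
    using assms PiE_ext[of k Basis "\<lambda>_. UNIV" "restrict (\<lambda>_. 0) Basis"] by fastforce
  then show "monomial k 0 = 0"
    unfolding monomial_def by (intro prod_zero) (auto intro!: bexI[of _ b])
  have "k b \<le> mdeg k"
    unfolding mdeg_def using b by (intro member_le_sum) auto
  then show "mdeg k \<ge> 1" using b by linarith
qed

text \<open>The quotient is \<open>1 / (1 - u)\<close> with \<open>u = 1 - f / f p\<close>. As
  \<open>u\<close> has no constant term, shrinking the radius by a factor \<open>t \<le> 1\<close>
  shrinks its majorant by at least the same factor. A majorant of at most \<open>1 / 2\<close> makes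
  the geometric series of expansions summable.\<close>

lemma has_expansion_inverse:
  fixes p :: "'a::euclidean_space"
  assumes f: "has_expansion p \<rho> multi_indices c (\<lambda>k. k) f" and \<rho>: "\<rho> > 0" and fp: "f p \<noteq> 0"
  obtains \<sigma> d where "\<sigma> > 0"
    "has_expansion p \<sigma> ((UNIV :: nat set) \<times> multi_indices) d snd (\<lambda>q. f p / f q)"
proof -
  define k0 :: "'a \<Rightarrow> nat" where "k0 = restrict (\<lambda>_. 0) Basis"
  define A where "A = multi_indices - {k0}"
  have k0: "k0 \<in> multi_indices" "monomial k0 = (\<lambda>_. 1)"
    by (auto simp: k0_def monomial_def fun_eq_iff)
  have A: "monomial k 0 = 0" "mdeg k \<ge> 1" if "k \<in> A" for k
    using monomial_zero[of k] that by (auto simp: A_def k0_def)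
  have sum: "(\<lambda>k. \<bar>c k\<bar> * \<rho> ^ mdeg k) summable_on A"
    using f by (auto simp: has_expansion_def A_def intro: summable_on_subset)
  have fA: "((\<lambda>k. c k * monomial k (q - p)) has_sum f q - c k0) A" if "q \<in> cube p \<rho>" for q
  proof -
    have "((\<lambda>k. c k * monomial k (q - p)) has_sum f q) multi_indices"
      using f that by (simp add: has_expansion_def)
    moreover have "((\<lambda>k. c k * monomial k (q - p)) has_sum c k0) {k0}"
      using has_sum_finite[of "{k0}" "\<lambda>k. c k * monomial k (q - p)"] by (simp add: k0)
    ultimately show ?thesis
      unfolding A_def by (rule has_sum_Diff) (use k0 in auto)
  qed
  \<comment> \<open>At the centre all monomials other than the constant one vanish.\<close>
  have "f p - c k0 = 0"
  proof (rule has_sum_unique)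
    show "((\<lambda>k. c k * monomial k (p - p)) has_sum f p - c k0) A"
      using fA[OF centre_in_cube] \<rho> by simp
    show "((\<lambda>k. c k * monomial k (p - p)) has_sum 0) A"
      by (rule has_sum_0) (simp add: A)
  qed
  then have ck0: "c k0 = f p" by simp
  define N where "N = (\<Sum>\<^sub>\<infinity>k\<in>A. \<bar>c k\<bar> * \<rho> ^ mdeg k) / \<bar>f p\<bar>"
  have N: "N \<ge> 0"
    unfolding N_def using \<rho> by (auto intro!: infsum_nonneg divide_nonneg_nonneg)
  \<comment> \<open>\<open>N\<close> is the majorant of \<open>u\<close> at radius
    \<open>\<rho>\<close>. The summand 1 covers \<open>N = 0\<close> and keeps \<open>t\<close>
    below 1.\<close>
  define t where "t = 1 / (2 * (1 + N))"
  have t: "t > 0" "t \<le> 1" "t * N \<le> 1 / 2"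
    using N by (auto simp: t_def field_simps)
  define \<sigma> where "\<sigma> = t * \<rho>"
  have \<sigma>: "\<sigma> > 0" "\<sigma> \<le> \<rho>" using t \<rho> by (auto simp: \<sigma>_def)
  define e where "e k = - c k / f p" for k
  define u where "u q = 1 - f q / f p" for q
  have eN: "((\<lambda>k. t * (\<bar>e k\<bar> * \<rho> ^ mdeg k)) has_sum t * N) A"
  proof -
    have "((\<lambda>k. t / \<bar>f p\<bar> * (\<bar>c k\<bar> * \<rho> ^ mdeg k)) has_sum t / \<bar>f p\<bar> * (\<Sum>\<^sub>\<infinity>k\<in>A. \<bar>c k\<bar> * \<rho> ^ mdeg k)) A"
      by (intro has_sum_cmult_right has_sum_infsum sum)
    then show ?thesis by (simp add: e_def N_def abs_divide)
  qed
  have e_le: "\<bar>e k\<bar> * \<sigma> ^ mdeg k \<le> t * (\<bar>e k\<bar> * \<rho> ^ mdeg k)" if "k \<in> A" for k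
  proof -
    have "t ^ mdeg k \<le> t ^ 1"
      using t A(2)[OF that] by (intro power_decreasing) auto
    then have "t ^ mdeg k * (\<bar>e k\<bar> * \<rho> ^ mdeg k) \<le> t * (\<bar>e k\<bar> * \<rho> ^ mdeg k)"
      using \<rho> by (intro mult_right_mono) auto
    then show ?thesis
      by (simp add: \<sigma>_def power_mult_distrib mult_ac)
  qed
  have e_sum: "(\<lambda>k. \<bar>e k\<bar> * \<sigma> ^ mdeg k) summable_on A"
    using has_sum_imp_summable[OF eN]
    by (rule summable_on_comparison_test) (use e_le \<sigma> in auto)
  have maj: "majorant \<sigma> A e (\<lambda>k. k) \<le> 1 / 2"
  proof -
    have "majorant \<sigma> A e (\<lambda>k. k) \<le> t * N"
      unfolding majorant_def using has_sum_infsum[OF e_sum] eN by (rule has_sum_mono) (rule e_le)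
    then show ?thesis using t by linarith
  qed
  have u_sum: "((\<lambda>k. e k * monomial k (q - p)) has_sum u q) A" if "q \<in> cube p \<sigma>" for q
  proof -
    have "q \<in> cube p \<rho>" using that cube_mono[OF \<sigma>(2), of p] by blast
    moreover have "- 1 / f p * (f q - c k0) = u q"
      using fp by (simp add: u_def ck0 field_simps)
    ultimately show ?thesis
      using has_sum_cmult_right[OF fA, of q "- 1 / f p"] by (simp add: e_def)
  qed
  have u: "has_expansion p \<sigma> A e (\<lambda>k. k) u"
    unfolding has_expansion_def using e_sum u_sum by blast
  have u_le: "\<bar>u q\<bar> \<le> 1 / 2" if "q \<in> cube p \<sigma>" for q
  proof -
    have "norm (u q) \<le> majorant \<sigma> A e (\<lambda>k. k)"
      unfolding majorant_def
    proof (rule norm_infsum_le[OF u_sum[OF that] has_sum_infsum[OF e_sum]])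
      show "norm (e k * monomial k (q - p)) \<le> \<bar>e k\<bar> * \<sigma> ^ mdeg k" for k
        using abs_monomial_le[OF that, of k] by (simp add: abs_mult mult_left_mono)
    qed
    then show ?thesis using maj by simp
  qed
  have geo: "((\<lambda>n. u q ^ n) has_sum f p / f q) UNIV" if "q \<in> cube p \<sigma>" for q
  proof -
    have lt: "norm (u q) < 1" using u_le[OF that] by simp
    then have "summable (\<lambda>n. norm (u q ^ n))"
      by (simp add: power_abs summable_geometric)
    moreover have "(\<lambda>n. u q ^ n) sums (1 / (1 - u q))"
      using lt by (rule geometric_sums)
    ultimately have "((\<lambda>n. u q ^ n) has_sum 1 / (1 - u q)) UNIV"
      by (rule norm_summable_imp_has_sum)
    then show ?thesis by (simp add: u_def)
  qed
  have "\<forall>n. \<exists>d. has_expansion p \<sigma> multi_indices d (\<lambda>k. k) (\<lambda>q. u q ^ n) \<and>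
      majorant \<sigma> multi_indices d (\<lambda>k. k) \<le> (1 / 2) ^ n"
    using has_expansion_power[OF u \<sigma>(1) maj] by blast
  from choice[OF this] obtain d where d: "\<And>n. has_expansion p \<sigma> multi_indices (d n) (\<lambda>k. k) (\<lambda>q. u q ^ n)"
    "\<And>n. majorant \<sigma> multi_indices (d n) (\<lambda>k. k) \<le> (1 / 2) ^ n"
    by blast
  have "(\<lambda>n. (1 / 2 :: real) ^ n) summable_on UNIV"
    by (intro summable_nonneg_imp_summable_on summable_geometric) auto
  have "has_expansion p \<sigma> (UNIV \<times> multi_indices) (\<lambda>(n, k). d n k) snd (\<lambda>q. f p / f q)"
    by (rule has_expansion_suminf[OF d \<open>(\<lambda>n. (1 / 2) ^ n) summable_on UNIV\<close> geo \<sigma>(1)])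
  with \<sigma>(1) show thesis by (rule that)
qed

section \<open>Closure properties of real analytic functions\<close>

lemma real_analytic_on_const: "(\<lambda>_. C) real_analytic_on S"
  by (rule has_expansion_imp_real_analytic)
    (intro exI conjI, rule zero_less_one, rule has_expansion_const)

lemma real_analytic_on_coord: "b \<in> Basis \<Longrightarrow> (\<lambda>q. q \<bullet> b) real_analytic_on S"
  by (rule has_expansion_imp_real_analytic)
    (intro exI conjI, rule zero_less_one, erule has_expansion_coord)

lemma has_expansion_subset:
  assumes "has_expansion p \<rho> A c \<kappa> f" "0 < \<sigma>" "\<sigma> \<le> \<rho>"
  shows "has_expansion p \<sigma> A c \<kappa> f"
  unfolding has_expansion_def
proof (intro conjI ballI)
  show "(\<lambda>a. \<bar>c a\<bar> * \<sigma> ^ mdeg (\<kappa> a)) summable_on A"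
  proof (rule summable_on_comparison_test)
    show "(\<lambda>a. \<bar>c a\<bar> * \<rho> ^ mdeg (\<kappa> a)) summable_on A"
      using assms by (simp add: has_expansion_def)
  qed (use assms in \<open>auto intro!: mult_left_mono power_mono\<close>)
  show "((\<lambda>a. c a * monomial (\<kappa> a) (q - p)) has_sum f q) A" if "q \<in> cube p \<sigma>" for q
    using assms that cube_mono[OF assms(3), of p] by (auto simp: has_expansion_def)
qed

lemma real_analytic_on_mult:
  fixes f g :: "'a::euclidean_space \<Rightarrow> real"
  assumes "f real_analytic_on S" "g real_analytic_on S"
  shows "(\<lambda>q. f q * g q) real_analytic_on S"
proof (rule has_expansion_imp_real_analytic)
  fix p assume p: "p \<in> S"
  obtain \<rho> c where \<rho>: "\<rho> > 0" and f: "has_expansion p \<rho> multi_indices c (\<lambda>k. k) f"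
    using real_analytic_imp_has_expansion[OF assms(1) p] .
  obtain \<sigma> d where \<sigma>: "\<sigma> > 0" and g: "has_expansion p \<sigma> multi_indices d (\<lambda>k. k) g"
    using real_analytic_imp_has_expansion[OF assms(2) p] .
  have fg: "has_expansion p (min \<rho> \<sigma>) multi_indices c (\<lambda>k. k) f"
    "has_expansion p (min \<rho> \<sigma>) multi_indices d (\<lambda>k. k) g"
    using \<rho> \<sigma> by (auto intro: has_expansion_subset[OF f] has_expansion_subset[OF g])
  have pos: "min \<rho> \<sigma> > 0" using \<rho> \<sigma> by simp
  show "\<exists>\<rho>>0. \<exists>A c \<kappa>. has_expansion p \<rho> (A :: (('a \<Rightarrow> nat) \<times> ('a \<Rightarrow> nat)) set) c \<kappa> (\<lambda>q. f q * g q)"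
    using pos has_expansion_mult(1)[OF fg pos] by (intro exI conjI)
qed

lemma real_analytic_on_divide:
  fixes f g :: "'a::euclidean_space \<Rightarrow> real"
  assumes "f real_analytic_on S" "g real_analytic_on S" "\<And>p. p \<in> S \<Longrightarrow> g p \<noteq> 0"
  shows "(\<lambda>q. f q / g q) real_analytic_on S"
proof -
  have "(\<lambda>q. 1 / g q) real_analytic_on S"
  proof (rule has_expansion_imp_real_analytic)
    fix p assume p: "p \<in> S"
    obtain \<rho> c where "\<rho> > 0" "has_expansion p \<rho> multi_indices c (\<lambda>k. k) g"
      using real_analytic_imp_has_expansion[OF assms(2) p] .
    then obtain \<sigma> d where \<sigma>: "\<sigma> > 0"
      and h: "has_expansion p \<sigma> ((UNIV :: nat set) \<times> multi_indices) d snd (\<lambda>q. g p / g q)"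
      using has_expansion_inverse assms(3)[OF p] by blast
    \<comment> \<open>\<open>has_expansion_inverse\<close> is normalised to the value 1 at the
      centre; this constant factor undoes that and accounts for the \<open>unit\<close> in the index
      type.\<close>
    have eq: "1 / g p * (g p / g q) = 1 / g q" for q
      using assms(3)[OF p] by simp
    show "\<exists>\<rho>>0. \<exists>A c \<kappa>. has_expansion p \<rho> (A :: (unit \<times> nat \<times> ('a \<Rightarrow> nat)) set) c \<kappa> (\<lambda>q. 1 / g q)"
      using has_expansion_mult(1)[OF has_expansion_const[of p \<sigma> "1 / g p"] h \<sigma>] \<sigma>
      unfolding eq by (intro exI conjI)
  qed
  from real_analytic_on_mult[OF assms(1) this] show ?thesis by simp
qed

section \<open>Partial derivatives of real analytic functions\<close>

text \<open>Both bounds compare with the non-negative binomial remainder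
  \<open>(a + \<delta>)\<^sup>n - a\<^sup>n - n \<delta> a\<^sup>n\<^sup>-\<^sup>1\<close>, which satisfies the same recursion.\<close>

lemma power_remainder_bound:
  fixes s t \<delta> :: real
  assumes \<delta>: "\<delta> > 0" and t: "\<bar>t\<bar> \<le> \<delta>"
  shows "\<bar>(s + t) ^ n - s ^ n - n * s ^ (n - 1) * t\<bar> \<le> (t / \<delta>)\<^sup>2 * (\<bar>s\<bar> + \<delta>) ^ n"
    and "n * \<bar>s\<bar> ^ (n - 1) * \<delta> \<le> (\<bar>s\<bar> + \<delta>) ^ n"
proof -
  define R where "R n = (s + t) ^ n - s ^ n - n * s ^ (n - 1) * t" for n
  define B where "B n = (\<bar>s\<bar> + \<delta>) ^ n - \<bar>s\<bar> ^ n - n * \<bar>s\<bar> ^ (n - 1) * \<delta>" for n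
  have R_Suc: "R (Suc n) = (s + t) * R n + n * t\<^sup>2 * s ^ (n - 1)" for n
    by (cases n) (simp_all add: R_def algebra_simps power2_eq_square)
  have B_Suc: "B (Suc n) = (\<bar>s\<bar> + \<delta>) * B n + n * \<delta>\<^sup>2 * \<bar>s\<bar> ^ (n - 1)" for n
    by (cases n) (simp_all add: B_def algebra_simps power2_eq_square)
  have B: "B n \<ge> 0" for n
    by (induction n) (use \<delta> in \<open>simp_all add: B_Suc, simp add: B_def\<close>)
  have R: "\<bar>R n\<bar> \<le> (t / \<delta>)\<^sup>2 * B n" for n
  proof (induction n)
    case 0
    then show ?case by (simp add: R_def B_def)
  next
    case (Suc n)
    have "\<bar>R (Suc n)\<bar> \<le> \<bar>s + t\<bar> * \<bar>R n\<bar> + n * t\<^sup>2 * \<bar>s\<bar> ^ (n - 1)"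
      unfolding R_Suc by (rule order_trans[OF abs_triangle_ineq]) (simp add: abs_mult power_abs)
    also have "\<dots> \<le> (\<bar>s\<bar> + \<delta>) * ((t / \<delta>)\<^sup>2 * B n) + n * t\<^sup>2 * \<bar>s\<bar> ^ (n - 1)"
      using Suc t \<delta> by (intro add_right_mono mult_mono) auto
    also have "\<dots> = (t / \<delta>)\<^sup>2 * B (Suc n)"
      using \<delta> by (simp add: B_Suc power_divide field_simps)
    finally show ?case .
  qed
  have "0 \<le> \<bar>s\<bar> ^ n" "0 \<le> n * \<bar>s\<bar> ^ (n - 1) * \<delta>"
    using \<delta> by auto
  then have "B n \<le> (\<bar>s\<bar> + \<delta>) ^ n"
    unfolding B_def by linarith
  then have "(t / \<delta>)\<^sup>2 * B n \<le> (t / \<delta>)\<^sup>2 * (\<bar>s\<bar> + \<delta>) ^ n"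
    by (intro mult_left_mono) auto
  then show "\<bar>(s + t) ^ n - s ^ n - n * s ^ (n - 1) * t\<bar> \<le> (t / \<delta>)\<^sup>2 * (\<bar>s\<bar> + \<delta>) ^ n"
    using R[of n] unfolding R_def by linarith
  show "n * \<bar>s\<bar> ^ (n - 1) * \<delta> \<le> (\<bar>s\<bar> + \<delta>) ^ n"
    using B[of n] zero_le_power[of "\<bar>s\<bar>" n] unfolding B_def by linarith
qed

text \<open>Turns an error bound that has been summed over the terms of a series directly into the
  derivative of the sum.\<close>

lemma quadratic_remainder_imp_DERIV:
  fixes F :: "real \<Rightarrow> real"
  assumes "\<delta> > 0" and F: "\<And>t. \<bar>t\<bar> \<le> \<delta> \<Longrightarrow> \<bar>F t - F 0 - t * D\<bar> \<le> C * t\<^sup>2"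
  shows "(F has_real_derivative D) (at 0)"
proof -
  have "((\<lambda>t. (F t - F 0) / t - D) \<longlongrightarrow> 0) (at 0)"
  proof (rule Lim_null_comparison)
    have "\<bar>(F t - F 0) / t - D\<bar> \<le> C * \<bar>t\<bar>" if "t \<noteq> 0" "\<bar>t\<bar> < \<delta>" for t
    proof -
      have "\<bar>(F t - F 0) / t - D\<bar> = \<bar>F t - F 0 - t * D\<bar> / \<bar>t\<bar>"
        using that by (simp add: diff_divide_distrib flip: abs_divide)
      also have "\<dots> \<le> C * t\<^sup>2 / \<bar>t\<bar>"
        using F[of t] that by (intro divide_right_mono) auto
      also have "\<dots> = C * \<bar>t\<bar>"
        using that by (simp add: power2_eq_square abs_if)
      finally show ?thesis .
    qed
    then show "\<forall>\<^sub>F t in at 0. norm ((F t - F 0) / t - D) \<le> C * \<bar>t\<bar>"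
      using \<open>\<delta> > 0\<close> by (auto simp: eventually_at)
    show "((\<lambda>t. C * \<bar>t\<bar>) \<longlongrightarrow> 0) (at 0)"
      by (auto intro!: tendsto_eq_intros)
  qed
  then show ?thesis
    using LIM_zero_cancel by (auto simp: DERIV_def)
qed

lemma has_sum_diff_real:
  fixes f g :: "'i \<Rightarrow> real"
  assumes "(f has_sum a) A" "(g has_sum b) A"
  shows "((\<lambda>x. f x - g x) has_sum a - b) A"
  using has_sum_add[OF assms(1) has_sum_cmult_right[OF assms(2), of "- 1"]] by simp

text \<open>Termwise differentiation by the quadratic remainder: moving by \<open>t\<close> in
  direction \<open>b\<close> leaves in each term an error of at most
  \<open>(t / \<delta>)\<^sup>2\<close> times its weight at radius \<open>\<rho>\<close>, where
  \<open>\<delta>\<close> is the gap between the radii. These errors sum to a multiple of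
  \<open>t\<^sup>2\<close>.\<close>

lemma has_expansion_partial:
  fixes p :: "'a::euclidean_space"
  assumes f: "has_expansion p \<rho> A c \<kappa> f" and \<sigma>: "0 < \<sigma>" "\<sigma> < \<rho>" and b: "b \<in> Basis"
  shows "has_expansion p \<sigma> A (\<lambda>a. \<kappa> a b * c a) (\<lambda>a. (\<kappa> a)(b := \<kappa> a b - 1)) (partial b f)"
    and "q \<in> cube p \<sigma> \<Longrightarrow> ((\<lambda>t. f (q + t *\<^sub>R b)) has_real_derivative partial b f q) (at 0)"
proof -
  define \<delta> where "\<delta> = \<rho> - \<sigma>"
  have \<delta>: "\<delta> > 0" using \<sigma> by (simp add: \<delta>_def)
  \<comment> \<open>\<open>R\<close> and \<open>Q\<close> are the degree and the value of the part
    of the monomial without the coordinate \<open>b\<close>; it is constant along the line of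
    differentiation.\<close>
  define R where "R a = (\<Sum>i\<in>Basis - {b}. \<kappa> a i)" for a
  define Q where "Q a v = (\<Prod>i\<in>Basis - {b}. (v \<bullet> i) ^ \<kappa> a i)" for a and v :: 'a
  have deg: "mdeg ((\<kappa> a)(b := m)) = m + R a" for a m
    unfolding mdeg_def R_def sum.remove[OF finite_Basis b] by simp
  have deg0: "mdeg (\<kappa> a) = \<kappa> a b + R a" for a
    using deg[of a "\<kappa> a b"] by simp
  have mon: "monomial ((\<kappa> a)(b := m)) v = (v \<bullet> b) ^ m * Q a v" for a m v
    unfolding monomial_def Q_def prod.remove[OF finite_Basis b] by simp
  have Qadd: "Q a (v + t *\<^sub>R b) = Q a v" for a v t
    unfolding Q_def using b by (intro prod.cong) (auto simp: inner_add_left inner_Basis)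
  have mon0: "monomial (\<kappa> a) (v + t *\<^sub>R b) = (v \<bullet> b + t) ^ \<kappa> a b * Q a v" for a v t
    using mon[of a "\<kappa> a b" "v + t *\<^sub>R b"] b by (simp add: Qadd inner_add_left)
  have Qle: "\<bar>Q a (q - p)\<bar> \<le> \<rho> ^ R a" if "q \<in> cube p \<rho>" for a q
    unfolding Q_def R_def abs_prod power_sum
    using that by (intro prod_mono) (auto simp: cube_def power_abs intro: power_mono)
  have sum: "(\<lambda>a. \<bar>c a\<bar> * \<rho> ^ mdeg (\<kappa> a)) summable_on A"
    using f by (simp add: has_expansion_def)
  \<comment> \<open>For \<open>\<kappa> a b = 0\<close> the truncated subtraction leaves the
    exponent 0, which is harmless because the coefficient is then 0.\<close>
  let ?c = "\<lambda>a. \<kappa> a b * c a" and ?\<kappa> = "\<lambda>a. (\<kappa> a)(b := \<kappa> a b - 1)"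
  \<comment> \<open>A Cauchy estimate: the factor \<open>\<kappa> a b\<close> from differentiation
    is absorbed by passing from \<open>\<sigma>\<close> to \<open>\<rho>\<close>, at the price of
    \<open>1 / \<delta>\<close>.\<close>
  have dsum: "(\<lambda>a. \<bar>?c a\<bar> * \<sigma> ^ mdeg (?\<kappa> a)) summable_on A"
  proof (rule summable_on_comparison_test)
    show "(\<lambda>a. 1 / \<delta> * (\<bar>c a\<bar> * \<rho> ^ mdeg (\<kappa> a))) summable_on A"
      using sum by (rule summable_on_cmult_right)
    show "\<bar>?c a\<bar> * \<sigma> ^ mdeg (?\<kappa> a) \<le> 1 / \<delta> * (\<bar>c a\<bar> * \<rho> ^ mdeg (\<kappa> a))" for a
    proof -
      have "\<kappa> a b * \<sigma> ^ (\<kappa> a b - 1) * \<delta> \<le> \<rho> ^ \<kappa> a b"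
        using power_remainder_bound(2)[OF \<delta>, of 0 "\<kappa> a b" \<sigma>] \<sigma> \<delta> by (simp add: \<delta>_def)
      moreover have "\<sigma> ^ R a \<le> \<rho> ^ R a"
        using \<sigma> by (intro power_mono) auto
      ultimately have "(\<kappa> a b * \<sigma> ^ (\<kappa> a b - 1) * \<delta>) * \<sigma> ^ R a \<le> \<rho> ^ \<kappa> a b * \<rho> ^ R a"
        using \<sigma> \<delta> by (intro mult_mono) auto
      then have "\<bar>c a\<bar> * ((\<kappa> a b * \<sigma> ^ (\<kappa> a b - 1) * \<delta>) * \<sigma> ^ R a) \<le> \<bar>c a\<bar> * \<rho> ^ mdeg (\<kappa> a)"
        by (intro mult_left_mono) (auto simp: deg0 power_add)
      then show ?thesis
        using \<delta> by (simp add: deg power_add abs_mult field_simps)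
    qed
  qed (use \<sigma> in auto)
  define D where "D q = (\<Sum>\<^sub>\<infinity>a\<in>A. ?c a * monomial (?\<kappa> a) (q - p))" for q
  have D: "((\<lambda>a. ?c a * monomial (?\<kappa> a) (q - p)) has_sum D q) A" if "q \<in> cube p \<sigma>" for q
    unfolding D_def using expansion_abs_summable[OF dsum that] by (rule has_sum_infsum)
  have deriv: "((\<lambda>t. f (q + t *\<^sub>R b)) has_real_derivative D q) (at 0)" if q: "q \<in> cube p \<sigma>" for q
  proof (rule quadratic_remainder_imp_DERIV[OF \<delta>])
    fix t :: real assume t: "\<bar>t\<bar> \<le> \<delta>"
    define s where "s = (q - p) \<bullet> b"
    have s: "\<bar>s\<bar> + \<delta> \<le> \<rho>"
      using q b by (auto simp: cube_def s_def \<delta>_def)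
    have q\<rho>: "q \<in> cube p \<rho>" using q cube_mono[of \<sigma> \<rho> p] \<sigma> by auto
    have "q + t *\<^sub>R b \<in> cube p \<rho>"
      unfolding cube_def
    proof (clarify)
      fix i :: 'a assume i: "i \<in> Basis"
      have "\<bar>(q - p) \<bullet> i\<bar> \<le> \<sigma>" using q i by (auto simp: cube_def)
      then show "\<bar>(q + t *\<^sub>R b - p) \<bullet> i\<bar> \<le> \<rho>"
        using t b i \<delta> by (auto simp: inner_simps inner_Basis \<delta>_def)
    qed
    then have "((\<lambda>a. c a * monomial (\<kappa> a) (q + t *\<^sub>R b - p)) has_sum f (q + t *\<^sub>R b)) A"
      using f by (simp add: has_expansion_def)
    moreover have "((\<lambda>a. c a * monomial (\<kappa> a) (q - p)) has_sum f q) A"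
      using f q\<rho> by (simp add: has_expansion_def)
    ultimately have "((\<lambda>a. c a * monomial (\<kappa> a) (q + t *\<^sub>R b - p) - c a * monomial (\<kappa> a) (q - p)
        - t * (?c a * monomial (?\<kappa> a) (q - p))) has_sum f (q + t *\<^sub>R b) - f q - t * D q) A"
      by (intro has_sum_diff_real has_sum_cmult_right D q)
    then have "norm (f (q + t *\<^sub>R b) - f q - t * D q) \<le> (t / \<delta>)\<^sup>2 * majorant \<rho> A c \<kappa>"
    proof (rule norm_infsum_le)
      show "((\<lambda>a. (t / \<delta>)\<^sup>2 * (\<bar>c a\<bar> * \<rho> ^ mdeg (\<kappa> a))) has_sum (t / \<delta>)\<^sup>2 * majorant \<rho> A c \<kappa>) A"
        unfolding majorant_def using sum by (intro has_sum_cmult_right has_sum_infsum)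
      show "norm (c a * monomial (\<kappa> a) (q + t *\<^sub>R b - p) - c a * monomial (\<kappa> a) (q - p)
        - t * (?c a * monomial (?\<kappa> a) (q - p))) \<le> (t / \<delta>)\<^sup>2 * (\<bar>c a\<bar> * \<rho> ^ mdeg (\<kappa> a))" for a
      proof -
        let ?n = "\<kappa> a b"
        have e1: "monomial (\<kappa> a) (q + t *\<^sub>R b - p) = (s + t) ^ ?n * Q a (q - p)"
          using mon0[of a "q - p" t] by (simp add: s_def algebra_simps)
        have e2: "monomial (\<kappa> a) (q - p) = s ^ ?n * Q a (q - p)"
          using mon0[of a "q - p" 0] by (simp add: s_def)
        have e3: "monomial (?\<kappa> a) (q - p) = s ^ (?n - 1) * Q a (q - p)"
          by (simp add: mon s_def)
        have "c a * monomial (\<kappa> a) (q + t *\<^sub>R b - p) - c a * monomial (\<kappa> a) (q - p)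
            - t * (?c a * monomial (?\<kappa> a) (q - p))
          = c a * (((s + t) ^ ?n - s ^ ?n - ?n * s ^ (?n - 1) * t) * Q a (q - p))"
          unfolding e1 e2 e3 by (simp add: algebra_simps)
        moreover have "\<bar>((s + t) ^ ?n - s ^ ?n - ?n * s ^ (?n - 1) * t) * Q a (q - p)\<bar>
            \<le> ((t / \<delta>)\<^sup>2 * \<rho> ^ ?n) * \<rho> ^ R a"
        proof -
          have "(\<bar>s\<bar> + \<delta>) ^ ?n \<le> \<rho> ^ ?n"
            using s \<delta> by (intro power_mono) auto
          then have "(t / \<delta>)\<^sup>2 * (\<bar>s\<bar> + \<delta>) ^ ?n \<le> (t / \<delta>)\<^sup>2 * \<rho> ^ ?n"
            by (intro mult_left_mono) auto
          then have "\<bar>(s + t) ^ ?n - s ^ ?n - ?n * s ^ (?n - 1) * t\<bar> \<le> (t / \<delta>)\<^sup>2 * \<rho> ^ ?n"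
            using power_remainder_bound(1)[OF \<delta> t, of s ?n] by linarith
          then show ?thesis
            unfolding abs_mult using Qle[OF q\<rho>, of a] \<sigma> by (intro mult_mono) auto
        qed
        ultimately have "norm (c a * monomial (\<kappa> a) (q + t *\<^sub>R b - p) - c a * monomial (\<kappa> a) (q - p)
            - t * (?c a * monomial (?\<kappa> a) (q - p))) \<le> \<bar>c a\<bar> * (((t / \<delta>)\<^sup>2 * \<rho> ^ ?n) * \<rho> ^ R a)"
          by (simp add: abs_mult mult_left_mono)
        then show ?thesis
          by (simp add: deg0 power_add mult_ac)
      qed
    qed
    then show "\<bar>f (q + t *\<^sub>R b) - f (q + 0 *\<^sub>R b) - t * D q\<bar> \<le> majorant \<rho> A c \<kappa> / \<delta>\<^sup>2 * t\<^sup>2"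
      by (simp add: power_divide mult_ac)
  qed
  have part: "partial b f q = D q" if "q \<in> cube p \<sigma>" for q
    unfolding partial_def using deriv[OF that] by (rule DERIV_imp_deriv)
  show "((\<lambda>t. f (q + t *\<^sub>R b)) has_real_derivative partial b f q) (at 0)" if "q \<in> cube p \<sigma>"
    using deriv[OF that] part[OF that] by simp
  show "has_expansion p \<sigma> A ?c ?\<kappa> (partial b f)"
    unfolding has_expansion_def using dsum D part by auto
qed

lemma real_analytic_on_partial:
  assumes "f real_analytic_on S" "b \<in> Basis"
  shows "partial b f real_analytic_on S"
proof (rule has_expansion_imp_real_analytic)
  fix p assume p: "p \<in> S"
  obtain \<rho> c where \<rho>: "\<rho> > 0" and f: "has_expansion p \<rho> multi_indices c (\<lambda>k. k) f"
    using real_analytic_imp_has_expansion[OF assms(1) p] .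
  then have "\<rho> / 2 > 0" "\<rho> / 2 < \<rho>" by auto
  from has_expansion_partial(1)[OF f this assms(2)] this(1)
  show "\<exists>\<rho>>0. \<exists>A c \<kappa>. has_expansion p \<rho> (A :: ('a \<Rightarrow> nat) set) c \<kappa> (partial b f)"
    by blast
qed

lemma real_analytic_on_has_partial:
  assumes "f real_analytic_on S" "p \<in> S" "b \<in> Basis"
  shows "((\<lambda>t. f (p + t *\<^sub>R b)) has_real_derivative partial b f p) (at 0)"
proof -
  obtain \<rho> c where \<rho>: "\<rho> > 0" and f: "has_expansion p \<rho> multi_indices c (\<lambda>k. k) f"
    using real_analytic_imp_has_expansion[OF assms(1,2)] .
  then have "\<rho> / 2 > 0" "\<rho> / 2 < \<rho>" by auto
  from has_expansion_partial(2)[OF f this assms(3)] this(1) show ?thesis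
    by (simp add: centre_in_cube)
qed

text \<open>Differentiating termwise in either order gives the same series, since for distinct
  directions the exponent updates commute. Each differentiation costs some radius, hence
  \<open>\<rho> / 2\<close> and \<open>\<rho> / 4\<close>.\<close>

lemma real_analytic_on_partial_commute:
  assumes "f real_analytic_on S" "p \<in> S" "b \<in> Basis" "b' \<in> Basis"
  shows "partial b (partial b' f) p = partial b' (partial b f) p"
proof (cases "b = b'")
  case False
  obtain \<rho> c where \<rho>: "\<rho> > 0" and f: "has_expansion p \<rho> multi_indices c (\<lambda>k. k) f"
    using real_analytic_imp_has_expansion[OF assms(1,2)] .
  then have \<sigma>: "0 < \<rho> / 2" "\<rho> / 2 < \<rho>" and \<tau>: "0 < \<rho> / 4" "\<rho> / 4 < \<rho> / 2" by auto
  have p: "p \<in> cube p (\<rho> / 4)" using \<rho> by (simp add: centre_in_cube)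
  note e = has_expansion_partial(1)[OF has_expansion_partial(1)[OF f \<sigma>] \<tau>]
  have "((\<lambda>k. real (k b') * (real (k b) * c k) * monomial (k(b := k b - 1, b' := k b' - 1)) (p - p))
      has_sum partial b' (partial b f) p) multi_indices"
    using has_expansionD[OF e[OF assms(3,4)] p] False by simp
  moreover have "((\<lambda>k. real (k b) * (real (k b') * c k) *
      monomial (k(b' := k b' - 1, b := k b - 1)) (p - p)) has_sum partial b (partial b' f) p) multi_indices"
    using has_expansionD[OF e[OF assms(4,3)] p] False by simp
  ultimately show ?thesis
    using False by (simp add: fun_upd_twist mult.left_commute has_sum_unique)
qed simp

text \<open>Here \<open>\<pi>\<close> selects coordinates and \<open>\<iota>\<close> names the one
  read for each target direction. Monomials pull back to monomials with exponent 0 in the directions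
  that \<open>\<pi>\<close> ignores, so the coefficients are unchanged.\<close>

lemma real_analytic_on_pullback:
  fixes f :: "'b::euclidean_space \<Rightarrow> real" and \<pi> :: "'a::euclidean_space \<Rightarrow> 'b"
  assumes f: "f real_analytic_on T" and \<pi>: "\<pi> ` S \<subseteq> T"
    and \<iota>: "inj_on \<iota> Basis" "\<iota> ` Basis \<subseteq> Basis" "\<And>q b. b \<in> Basis \<Longrightarrow> \<pi> q \<bullet> b = q \<bullet> \<iota> b"
  shows "(\<lambda>q. f (\<pi> q)) real_analytic_on S"
proof (rule has_expansion_imp_real_analytic)
  fix p assume "p \<in> S"
  then obtain \<rho> c where \<rho>: "\<rho> > 0" and fe: "has_expansion (\<pi> p) \<rho> multi_indices c (\<lambda>k. k) f"
    using real_analytic_imp_has_expansion[OF f, of "\<pi> p"] \<pi> by blast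
  define \<kappa> where "\<kappa> k i = (if i \<in> \<iota> ` Basis then k (inv_into Basis \<iota> i) else 0)"
    for k :: "'b \<Rightarrow> nat" and i
  have \<kappa>: "\<kappa> k (\<iota> b) = k b" if "b \<in> Basis" for k b
    using that \<iota>(1) by (simp add: \<kappa>_def)
  have deg: "mdeg (\<kappa> k) = mdeg k" for k
  proof -
    have "mdeg (\<kappa> k) = sum (\<kappa> k) (\<iota> ` Basis)"
      unfolding mdeg_def using \<iota>(2) by (intro sum.mono_neutral_right) (auto simp: \<kappa>_def)
    then show ?thesis by (simp add: sum.reindex[OF \<iota>(1)] mdeg_def \<kappa>)
  qed
  have mon: "monomial (\<kappa> k) (q - p) = monomial k (\<pi> q - \<pi> p)" for k q
  proof -
    have "monomial (\<kappa> k) (q - p) = (\<Prod>i\<in>\<iota> ` Basis. ((q - p) \<bullet> i) ^ \<kappa> k i)"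
      unfolding monomial_def using \<iota>(2) by (intro prod.mono_neutral_right) (auto simp: \<kappa>_def)
    then show ?thesis
      by (simp add: prod.reindex[OF \<iota>(1)] monomial_def \<kappa> inner_diff_left \<iota>(3))
  qed
  have "\<pi> q \<in> cube (\<pi> p) \<rho>" if "q \<in> cube p \<rho>" for q
    using that \<iota>(2) by (auto simp: cube_def inner_diff_left \<iota>(3))
  with fe have "has_expansion p \<rho> multi_indices c \<kappa> (\<lambda>q. f (\<pi> q))"
    by (simp add: has_expansion_def deg mon)
  with \<rho> show "\<exists>\<rho>>0. \<exists>A c \<kappa>. has_expansion p \<rho> (A :: ('b \<Rightarrow> nat) set) c \<kappa> (\<lambda>q. f (\<pi> q))"
    by blast
qed

section \<open>Calculus on the jet space\<close>

text \<open>\<open>partial\<close> rests on \<open>deriv\<close>, an arbitrary number where no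
  derivative exists. This predicate certifies genuine derivatives along the basis directions, as the
  sum and product rules require.\<close>

definition partially_differentiable :: "('a::euclidean_space \<Rightarrow> real) \<Rightarrow> 'a \<Rightarrow> bool" where
  "partially_differentiable f p \<longleftrightarrow>
    (\<forall>b\<in>Basis. ((\<lambda>t. f (p + t *\<^sub>R b)) has_real_derivative partial b f p) (at 0))"

lemma partially_differentiableD:
  assumes "partially_differentiable f p" "b \<in> Basis"
  shows "((\<lambda>t. f (p + t *\<^sub>R b)) has_real_derivative partial b f p) (at 0)"
  using assms by (simp add: partially_differentiable_def)

lemma partial_eqI: "((\<lambda>t. f (p + t *\<^sub>R b)) has_real_derivative D) (at 0) \<Longrightarrow> partial b f p = D"
  unfolding partial_def by (rule DERIV_imp_deriv)

lemma partially_differentiableI: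
  assumes "\<And>b. b \<in> Basis \<Longrightarrow> ((\<lambda>t. f (p + t *\<^sub>R b)) has_real_derivative D b) (at 0)"
  shows "partially_differentiable f p"
  unfolding partially_differentiable_def using assms partial_eqI by metis

text \<open>The coefficients of a generator are known on \<open>S\<close> only; openness allows
  replacing them there by explicit formulas before differentiating.\<close>

lemma partial_cong:
  assumes "open U" "p \<in> U" and eq: "\<And>q. q \<in> U \<Longrightarrow> f q = g q"
  shows "partial b f p = partial b g p"
proof -
  have "((\<lambda>t. p + t *\<^sub>R b) \<longlongrightarrow> p) (nhds 0)"
    by (auto intro!: tendsto_eq_intros filterlim_ident)
  then have "\<forall>\<^sub>F t in nhds 0. p + t *\<^sub>R b \<in> U"
    using assms(1,2) by (auto simp: tendsto_def)
  then have "\<forall>\<^sub>F t in nhds 0. f (p + t *\<^sub>R b) = g (p + t *\<^sub>R b)"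
    by eventually_elim (rule eq)
  then show ?thesis
    unfolding partial_def by (intro deriv_cong_ev) auto
qed

context
  fixes f g :: "'a::euclidean_space \<Rightarrow> real" and p :: 'a
  assumes f: "partially_differentiable f p" and g: "partially_differentiable g p"
begin

lemma
  shows partial_add: "b \<in> Basis \<Longrightarrow> partial b (\<lambda>q. f q + g q) p = partial b f p + partial b g p"
    and partially_differentiable_add: "partially_differentiable (\<lambda>q. f q + g q) p"
proof -
  have *: "((\<lambda>t. f (p + t *\<^sub>R b) + g (p + t *\<^sub>R b)) has_real_derivative
      partial b f p + partial b g p) (at 0)" if "b \<in> Basis" for b
    by (intro DERIV_add partially_differentiableD f g that)
  show "b \<in> Basis \<Longrightarrow> partial b (\<lambda>q. f q + g q) p = partial b f p + partial b g p"
    by (intro partial_eqI *)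
  show "partially_differentiable (\<lambda>q. f q + g q) p"
    by (rule partially_differentiableI[OF *])
qed

lemma partial_diff: "b \<in> Basis \<Longrightarrow> partial b (\<lambda>q. f q - g q) p = partial b f p - partial b g p"
  by (intro partial_eqI DERIV_diff partially_differentiableD f g)

lemma
  shows partial_mult:
      "b \<in> Basis \<Longrightarrow> partial b (\<lambda>q. f q * g q) p = partial b f p * g p + f p * partial b g p"
    and partially_differentiable_mult: "partially_differentiable (\<lambda>q. f q * g q) p"
proof -
  have *: "((\<lambda>t. f (p + t *\<^sub>R b) * g (p + t *\<^sub>R b)) has_real_derivative
      partial b f p * g p + f p * partial b g p) (at 0)" if "b \<in> Basis" for b
    using DERIV_mult[OF partially_differentiableD[OF f that] partially_differentiableD[OF g that]]
    by (simp add: mult_ac)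
  show "b \<in> Basis \<Longrightarrow> partial b (\<lambda>q. f q * g q) p = partial b f p * g p + f p * partial b g p"
    by (intro partial_eqI *)
  show "partially_differentiable (\<lambda>q. f q * g q) p"
    by (rule partially_differentiableI[OF *])
qed

end

lemma
  shows partial_const [simp]: "partial b (\<lambda>_. C) = (\<lambda>_. 0)"
    and partially_differentiable_const [simp]: "partially_differentiable (\<lambda>_. C) p"
  by (auto intro!: partially_differentiableI partial_eqI DERIV_const simp: fun_eq_iff)

lemma partial_minus:
  assumes "partially_differentiable f p" "b \<in> Basis"
  shows "partial b (\<lambda>q. - f q) p = - partial b f p"
  by (intro partial_eqI DERIV_minus partially_differentiableD assms)

lemma
  shows jet_partial_coord: "jet_partial i (\<lambda>p. p $ j) p = (if i = j then 1 else 0)"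
    and partially_differentiable_coord [simp]: "partially_differentiable (\<lambda>p::jet. p $ j) p"
proof -
  have *: "((\<lambda>t. (p + t *\<^sub>R b) $ j) has_real_derivative b $ j) (at 0)" for b :: jet
    by (auto intro!: derivative_eq_intros)
  show "jet_partial i (\<lambda>p. p $ j) p = (if i = j then 1 else 0)"
    using partial_eqI[OF *[of "axis i 1"]] by (simp add: axis_def)
  show "partially_differentiable (\<lambda>p::jet. p $ j) p"
    by (rule partially_differentiableI[OF *])
qed

section \<open>Functions on the base space and total derivatives\<close>

abbreviation "d_bx \<equiv> partial ((1, 0, 0, 0) :: base)"
abbreviation "d_by \<equiv> partial ((0, 1, 0, 0) :: base)"
abbreviation "d_bw \<equiv> partial ((0, 0, 1, 0) :: base)"
abbreviation "d_bE \<equiv> partial ((0, 0, 0, 1) :: base)"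

lemma base_Basis: "(Basis :: base set) = {(1, 0, 0, 0), (0, 1, 0, 0), (0, 0, 1, 0), (0, 0, 0, 1)}"
  by (auto simp: Basis_prod_def zero_prod_def)

lemma base_point_line:
  "base_point (p + t *\<^sub>R axis i 1) = base_point p + t *\<^sub>R
    (if i = jx then (1, 0, 0, 0) else if i = jy then (0, 1, 0, 0) else if i = jw then (0, 0, 1, 0)
     else if i = jE then (0, 0, 0, 1) else 0)"
  by (cases i) (auto simp: base_point_def axis_def zero_prod_def)

lemma jet_partial_lift:
  "jet_partial i (lift c) p =
    (if i = jx then lift (d_bx c) p else if i = jy then lift (d_by c) p
     else if i = jw then lift (d_bw c) p else if i = jE then lift (d_bE c) p else 0)"
  by (simp add: partial_def lift_def base_point_line)

lemma partially_differentiable_lift: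
  assumes "partially_differentiable c (base_point p)"
  shows "partially_differentiable (lift c) p"
  unfolding partially_differentiable_def
proof
  fix b :: jet assume "b \<in> Basis"
  then obtain i where b: "b = axis i 1" by (auto simp: Basis_vec_def)
  show "((\<lambda>t. lift c (p + t *\<^sub>R b)) has_real_derivative partial b (lift c) p) (at 0)"
    unfolding b jet_partial_lift
    using assms by (auto simp: lift_def base_point_line partially_differentiable_def base_Basis)
qed

lemma axis_Basis [simp]: "axis i (1::real) \<in> Basis"
  by (simp add: axis_in_Basis_iff)

lemma
  assumes "open U" "p \<in> U" "\<And>q. q \<in> U \<Longrightarrow> f q = g q"
  shows Dx_cong: "Dx f p = Dx g p" and Dy_cong: "Dy f p = Dy g p"
  unfolding Dx_def Dy_def using partial_cong[OF assms] by simp_all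

lemma
  shows Dx_const [simp]: "Dx (\<lambda>_. C) p = 0" and Dy_const [simp]: "Dy (\<lambda>_. C) p = 0"
  by (simp_all add: Dx_def Dy_def)

lemma
  assumes "partially_differentiable f p" "partially_differentiable g p"
  shows Dy_add: "Dy (\<lambda>q. f q + g q) p = Dy f p + Dy g p"
    and Dx_diff: "Dx (\<lambda>q. f q - g q) p = Dx f p - Dx g p"
    and Dy_diff: "Dy (\<lambda>q. f q - g q) p = Dy f p - Dy g p"
    and Dx_mult: "Dx (\<lambda>q. f q * g q) p = Dx f p * g p + f p * Dx g p"
    and Dy_mult: "Dy (\<lambda>q. f q * g q) p = Dy f p * g p + f p * Dy g p"
  by (simp_all add: Dx_def Dy_def partial_add partial_diff partial_mult assms algebra_simps)

lemma Dx_lift: "Dx (lift c) p = lift (d_bx c) p + p $ jwx * lift (d_bw c) p + p $ jEx * lift (d_bE c) p"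
  and Dy_lift: "Dy (lift c) p = lift (d_by c) p + p $ jwy * lift (d_bw c) p + p $ jEy * lift (d_bE c) p"
  by (simp_all add: Dx_def Dy_def jet_partial_lift)

lemma
  shows Dx_wx: "Dx (\<lambda>p. p $ jwx) p = p $ jwxx" and Dx_wy: "Dx (\<lambda>p. p $ jwy) p = p $ jwxy"
    and Dx_Ey: "Dx (\<lambda>p. p $ jEy) p = p $ jExy"
    and Dy_wy: "Dy (\<lambda>p. p $ jwy) p = p $ jwyy" and Dy_Ey: "Dy (\<lambda>p. p $ jEy) p = p $ jEyy"
  by (simp_all add: Dx_def Dy_def jet_partial_coord)

lemma jet_partial_equation_F:
  "jet_partial i equation_F p =
    (if i = jE then p $ jwxx + p $ jwyy else if i = jwx then p $ jEx else if i = jEx then p $ jwx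
     else if i = jwy then p $ jEy else if i = jEy then p $ jwy
     else if i = jwxx \<or> i = jwyy then p $ jE else 0)"
  unfolding equation_F_def[abs_def]
  by (simp add: partial_add partial_mult partially_differentiable_add partially_differentiable_mult
      jet_partial_coord)

lemma open_jets_over: "open S \<Longrightarrow> open (base_point -` S)"
  by (rule open_vimage) (auto simp: base_point_def[abs_def] intro!: continuous_intros)

text \<open>Identities without regularity hypotheses: both sides are \<open>deriv\<close> of the
  same function of one variable, or that function is constant.\<close>

lemma
  shows d_by_yw: "d_by (\<lambda>(x, y, w, E). h (y, w)) = (\<lambda>(x, y, w, E). d_y h (y, w))"
    and d_bw_yw: "d_bw (\<lambda>(x, y, w, E). h (y, w)) = (\<lambda>(x, y, w, E). d_w h (y, w))"
    and d_bx_yw: "d_bx (\<lambda>(x, y, w, E). h (y, w)) = (\<lambda>_. 0)"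
    and d_bE_yw: "d_bE (\<lambda>(x, y, w, E). h (y, w)) = (\<lambda>_. 0)"
  by (simp_all add: partial_def fun_eq_iff)

section \<open>Determining equations of a reduced generator\<close>

lemma partially_differentiable_yw:
  assumes "partially_differentiable h (y, w)"
  shows "partially_differentiable (\<lambda>(x, y, w, E). h (y, w)) ((x, y, w, E) :: base)"
proof -
  have B: "(1, 0) \<in> (Basis :: (real \<times> real) set)" "(0, 1) \<in> (Basis :: (real \<times> real) set)"
    by (auto simp: Basis_prod_def)
  from partially_differentiableD[OF assms B(1)] partially_differentiableD[OF assms B(2)]
  show ?thesis
    unfolding partially_differentiable_def base_Basis
    by (simp add: d_by_yw d_bw_yw d_bx_yw d_bE_yw)
qed

text \<open>One setting for both halves of the theorem: \<open>\<psi>\<close> is the claimed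
  coefficient for existence and an unknown one for uniqueness. Conditions on \<open>\<xi>\<close>
  and \<open>\<phi>\<close> are imposed on \<open>S\<close> only, and \<open>f\<close> has the
  derivatives that the second prolongation meets.\<close>

locale reduced_generator =
  fixes S :: "base set" and \<Omega> :: "(real \<times> real) set" and f :: "real \<times> real \<Rightarrow> real"
    and \<xi> \<phi> \<psi> :: "base \<Rightarrow> real"
  assumes S: "open S" "\<And>x y w E. (x, y, w, E) \<in> S \<Longrightarrow> (y, w) \<in> \<Omega>"
      "\<And>x y w E. (x, y, w, E) \<in> S \<Longrightarrow> E \<noteq> 0"
    and f: "\<And>q. q \<in> \<Omega> \<Longrightarrow> partially_differentiable f q"
      "\<And>q. q \<in> \<Omega> \<Longrightarrow> partially_differentiable (d_y f) q"
      "\<And>q. q \<in> \<Omega> \<Longrightarrow> partially_differentiable (d_w f) q"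
      "\<And>q. q \<in> \<Omega> \<Longrightarrow> d_w (d_y f) q = d_y (d_w f) q"
    and \<xi>: "\<And>q. q \<in> S \<Longrightarrow> \<xi> q = 0"
    and \<phi>: "\<And>x y w E. (x, y, w, E) \<in> S \<Longrightarrow> \<phi> (x, y, w, E) = f (y, w)"
    and \<psi>: "\<And>q. q \<in> S \<Longrightarrow> partially_differentiable \<psi> q"
begin

definition yw :: "(real \<times> real \<Rightarrow> real) \<Rightarrow> jet \<Rightarrow> real" where
  "yw h = lift (\<lambda>(x, y, w, E). h (y, w))"

definition U :: "jet set" where "U = base_point -` S"

lemma open_U: "open U"
  unfolding U_def by (rule open_jets_over) (rule S)

lemma in_\<Omega>: "p \<in> U \<Longrightarrow> (p $ jy, p $ jw) \<in> \<Omega>"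
  using S(2) by (auto simp: U_def base_point_def)

lemma yw_differentiable:
  assumes "p \<in> U" "\<And>q. q \<in> \<Omega> \<Longrightarrow> partially_differentiable h q"
  shows "partially_differentiable (yw h) p"
  unfolding yw_def using assms in_\<Omega>[OF assms(1)]
  by (auto intro!: partially_differentiable_lift partially_differentiable_yw simp: base_point_def)

lemma \<psi>_differentiable: "p \<in> U \<Longrightarrow> partially_differentiable (lift \<psi>) p"
  by (rule partially_differentiable_lift) (use \<psi> in \<open>simp add: U_def\<close>)

lemma Dx_yw: "Dx (yw h) p = p $ jwx * yw (d_w h) p"
  and Dy_yw: "Dy (yw h) p = yw (d_y h) p + p $ jwy * yw (d_w h) p"
  by (simp_all add: yw_def Dx_lift Dy_lift d_by_yw d_bw_yw d_bx_yw d_bE_yw) (simp_all add: lift_def)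

lemma lift_\<xi>: "p \<in> U \<Longrightarrow> lift \<xi> p = 0"
  by (simp add: U_def lift_def \<xi>)

lemma lift_\<phi>: "p \<in> U \<Longrightarrow> lift \<phi> p = yw f p"
  by (simp add: U_def lift_def yw_def base_point_def \<phi>)

text \<open>As \<open>\<xi>\<close> vanishes on an open set and \<open>\<eta> = 1\<close> is
  constant, both correction terms of the recursion are zero: prolongation is plain total
  differentiation.\<close>

lemma
  assumes "p \<in> U"
  shows prolong_step_Dx: "prolong_step Dx \<xi> (\<lambda>_. 1) i j c p = Dx c p"
    and prolong_step_Dy: "prolong_step Dy \<xi> (\<lambda>_. 1) i j c p = Dy c p"
proof -
  have "lift (\<lambda>_. 1) = (\<lambda>_. 1)" by (simp add: lift_def fun_eq_iff)
  moreover have "Dx (lift \<xi>) p = 0" "Dy (lift \<xi>) p = 0"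
    using Dx_cong[OF open_U assms, of "lift \<xi>" "\<lambda>_. 0"] Dy_cong[OF open_U assms, of "lift \<xi>" "\<lambda>_. 0"]
      lift_\<xi> by simp_all
  ultimately show "prolong_step Dx \<xi> (\<lambda>_. 1) i j c p = Dx c p"
    "prolong_step Dy \<xi> (\<lambda>_. 1) i j c p = Dy c p"
    by (simp_all add: prolong_step_def)
qed

section \<open>The second prolongation applied to the equation\<close>

lemma Dx_\<phi>: "p \<in> U \<Longrightarrow> Dx (lift \<phi>) p = p $ jwx * yw (d_w f) p"
  using Dx_cong[OF open_U _ lift_\<phi>] by (simp add: Dx_yw)

lemma Dy_\<phi>: "p \<in> U \<Longrightarrow> Dy (lift \<phi>) p = yw (d_y f) p + p $ jwy * yw (d_w f) p"
  using Dy_cong[OF open_U _ lift_\<phi>] by (simp add: Dy_yw)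

lemma second_\<phi>x:
  assumes p: "p \<in> U"
  shows "prolong_step Dx \<xi> (\<lambda>_. 1) i j (prolong_step Dx \<xi> (\<lambda>_. 1) jwx jwy (lift \<phi>)) p =
    p $ jwxx * yw (d_w f) p + (p $ jwx)\<^sup>2 * yw (d_w (d_w f)) p"
proof -
  have "Dx (prolong_step Dx \<xi> (\<lambda>_. 1) jwx jwy (lift \<phi>)) p = Dx (\<lambda>p. p $ jwx * yw (d_w f) p) p"
    by (rule Dx_cong[OF open_U p]) (simp add: prolong_step_Dx Dx_\<phi>)
  then show ?thesis
    by (simp add: prolong_step_Dx[OF p] Dx_mult yw_differentiable[OF p] f Dx_wx Dx_yw power2_eq_square)
qed

lemma second_\<phi>y:
  assumes p: "p \<in> U"
  shows "prolong_step Dy \<xi> (\<lambda>_. 1) i j (prolong_step Dy \<xi> (\<lambda>_. 1) jwx jwy (lift \<phi>)) p =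
    yw (d_y (d_y f)) p + 2 * p $ jwy * yw (d_y (d_w f)) p + p $ jwyy * yw (d_w f) p
      + (p $ jwy)\<^sup>2 * yw (d_w (d_w f)) p"
proof -
  have "Dy (prolong_step Dy \<xi> (\<lambda>_. 1) jwx jwy (lift \<phi>)) p =
      Dy (\<lambda>p. yw (d_y f) p + p $ jwy * yw (d_w f) p) p"
    by (rule Dy_cong[OF open_U p]) (simp add: prolong_step_Dy Dy_\<phi>)
  moreover have "yw (d_w (d_y f)) p = yw (d_y (d_w f)) p"
    using f(4)[OF in_\<Omega>[OF p]] by (simp add: yw_def lift_def base_point_def)
  ultimately show ?thesis
    by (simp add: prolong_step_Dy[OF p] Dy_add Dy_mult partially_differentiable_mult
        yw_differentiable[OF p] f Dy_wy Dy_yw power2_eq_square algebra_simps)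
qed

lemma pr2_equation_F:
  assumes p: "p \<in> U"
  shows "pr2 \<xi> (\<lambda>_. 1) \<phi> \<psi> equation_F p =
    p $ jwx * yw (d_w f) p * p $ jEx + (yw (d_y f) p + p $ jwy * yw (d_w f) p) * p $ jEy
    + (lift (d_bx \<psi>) p + p $ jwx * lift (d_bw \<psi>) p + p $ jEx * lift (d_bE \<psi>) p) * p $ jwx
    + (lift (d_by \<psi>) p + p $ jwy * lift (d_bw \<psi>) p + p $ jEy * lift (d_bE \<psi>) p) * p $ jwy
    + lift \<psi> p * (p $ jwxx + p $ jwyy)
    + p $ jE * (p $ jwxx * yw (d_w f) p + (p $ jwx)\<^sup>2 * yw (d_w (d_w f)) p
      + yw (d_y (d_y f)) p + 2 * p $ jwy * yw (d_y (d_w f)) p + p $ jwyy * yw (d_w f) p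
      + (p $ jwy)\<^sup>2 * yw (d_w (d_w f)) p)"
  unfolding pr2_def Let_def second_\<phi>x[OF p] second_\<phi>y[OF p]
  by (simp add: pr1_def prolong_step_Dx[OF p] prolong_step_Dy[OF p] Dx_\<phi>[OF p] Dy_\<phi>[OF p]
      Dx_lift[of \<psi>] Dy_lift[of \<psi>] jet_partial_equation_F algebra_simps)

section \<open>The invariants and the side conditions\<close>

lemma invariant_w_eq: "p \<in> U \<Longrightarrow> invariant_w \<xi> \<phi> p = p $ jwy - yw f p"
  by (simp add: invariant_w_def lift_\<xi> lift_\<phi>)

lemma invariant_E_eq: "p \<in> U \<Longrightarrow> invariant_E \<xi> \<psi> p = p $ jEy - lift \<psi> p"
  by (simp add: invariant_E_def lift_\<xi>)

lemma
  assumes p: "p \<in> U"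
  shows Dx_invariant_w: "Dx (invariant_w \<xi> \<phi>) p = p $ jwxy - p $ jwx * yw (d_w f) p"
    and Dy_invariant_w:
      "Dy (invariant_w \<xi> \<phi>) p = p $ jwyy - (yw (d_y f) p + p $ jwy * yw (d_w f) p)"
    and Dx_invariant_E: "Dx (invariant_E \<xi> \<psi>) p = p $ jExy - Dx (lift \<psi>) p"
    and Dy_invariant_E: "Dy (invariant_E \<xi> \<psi>) p = p $ jEyy - Dy (lift \<psi>) p"
  using Dx_cong[OF open_U p invariant_w_eq] Dy_cong[OF open_U p invariant_w_eq]
    Dx_cong[OF open_U p invariant_E_eq] Dy_cong[OF open_U p invariant_E_eq]
  by (simp_all add: Dx_diff Dy_diff yw_differentiable[OF p] f \<psi>_differentiable[OF p]
      Dx_wy Dx_Ey Dy_wy Dy_Ey Dx_yw Dy_yw)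

text \<open>For \<open>w\<close> the result is \<open>(w_y - f) * f_w\<close>, for \<open>E\<close>
  it is \<open>(w_y - f) * \<psi>_w + (E_y - \<psi>) * \<psi>_E\<close>; both vanish where the
  invariants do.\<close>

lemma
  assumes p: "p \<in> U"
  shows pr1_invariant_w: "invariant_w \<xi> \<phi> p = 0 \<Longrightarrow> pr1 \<xi> (\<lambda>_. 1) \<phi> \<psi> (invariant_w \<xi> \<phi>) p = 0"
    and pr1_invariant_E: "invariant_w \<xi> \<phi> p = 0 \<Longrightarrow> invariant_E \<xi> \<psi> p = 0 \<Longrightarrow>
      pr1 \<xi> (\<lambda>_. 1) \<phi> \<psi> (invariant_E \<xi> \<psi>) p = 0"
proof -
  have 1: "jet_partial i (invariant_w \<xi> \<phi>) p = (if i = jwy then 1 else 0) - jet_partial i (yw f) p" for i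
    using partial_cong[OF open_U p invariant_w_eq, where b = "axis i 1"]
    by (simp add: partial_diff yw_differentiable[OF p] f jet_partial_coord)
  have 2: "jet_partial i (invariant_E \<xi> \<psi>) p =
      (if i = jEy then 1 else 0) - jet_partial i (lift \<psi>) p" for i
    using partial_cong[OF open_U p invariant_E_eq, where b = "axis i 1"]
    by (simp add: partial_diff \<psi>_differentiable[OF p] jet_partial_coord)
  have one: "lift (\<lambda>_. 1) p = 1" by (simp add: lift_def)
  show "pr1 \<xi> (\<lambda>_. 1) \<phi> \<psi> (invariant_w \<xi> \<phi>) p = 0" if "invariant_w \<xi> \<phi> p = 0"
    using that invariant_w_eq[OF p]
    by (simp add: pr1_def 1 one lift_\<xi>[OF p] lift_\<phi>[OF p] prolong_step_Dx[OF p] prolong_step_Dy[OF p]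
        Dy_\<phi>[OF p] yw_def jet_partial_lift d_by_yw d_bw_yw d_bx_yw d_bE_yw) (simp add: lift_def)
  show "pr1 \<xi> (\<lambda>_. 1) \<phi> \<psi> (invariant_E \<xi> \<psi>) p = 0"
    if "invariant_w \<xi> \<phi> p = 0" "invariant_E \<xi> \<psi> p = 0"
    using that invariant_w_eq[OF p] invariant_E_eq[OF p]
    by (simp add: pr1_def 2 one lift_\<xi>[OF p] lift_\<phi>[OF p] prolong_step_Dx[OF p] prolong_step_Dy[OF p]
        Dy_lift jet_partial_lift)
qed

text \<open>The coefficients of \<open>E\<^sub>x w\<^sub>x\<close>, \<open>w\<^sub>x\<^sup>2\<close>, \<open>w\<^sub>x\<close> and \<open>1\<close> in the invariance condition, after
  all other jet coordinates have been eliminated.\<close>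

definition determining_equations :: "base \<Rightarrow> bool" where
  "determining_equations q \<longleftrightarrow> (case q of (x, y, w, E) \<Rightarrow>
    d_bE \<psi> q = \<psi> q / E \<and> d_bw \<psi> q = - E * d_w (d_w f) (y, w) \<and> d_bx \<psi> q = 0 \<and>
    (d_y f (y, w) + f (y, w) * d_w f (y, w)) * \<psi> q
      + f (y, w) * (d_by \<psi> q + f (y, w) * d_bw \<psi> q + \<psi> q * d_bE \<psi> q)
      - (\<psi> q / E + d_w f (y, w)) * (1 + f (y, w) * \<psi> q)
      + E * (d_y (d_y f) (y, w) + 2 * f (y, w) * d_y (d_w f) (y, w)
        + (f (y, w))\<^sup>2 * d_w (d_w f) (y, w)) = 0)"

definition on_solution_jet :: "jet \<Rightarrow> bool" where
  "on_solution_jet p \<longleftrightarrow> p \<in> U \<and> equation_F p = 0 \<and>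
    invariant_w \<xi> \<phi> p = 0 \<and> invariant_E \<xi> \<psi> p = 0 \<and>
    Dx (invariant_w \<xi> \<phi>) p = 0 \<and> Dy (invariant_w \<xi> \<phi>) p = 0 \<and>
    Dx (invariant_E \<xi> \<psi>) p = 0 \<and> Dy (invariant_E \<xi> \<psi>) p = 0"

text \<open>\<open>w_xx\<close> and \<open>w_yy\<close> enter only through their sum, with the
  factor \<open>\<psi> + E * f_w\<close>. On the equation, \<open>E\<close> times that sum is
  \<open>- (1 + w_x * E_x + w_y * E_y)\<close>, which produces \<open>\<psi> / E + f_w\<close>; its
  \<open>f_w\<close> cancels the one from the first prolongation in the coefficient of
  \<open>w_x * E_x\<close>.\<close>

lemma pr2_on_solution_jet:
  assumes p: "on_solution_jet p" and q: "base_point p = q" "q = (x, y, w, E)"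
  shows "pr2 \<xi> (\<lambda>_. 1) \<phi> \<psi> equation_F p =
    p $ jwx * p $ jEx * (d_bE \<psi> q - \<psi> q / E)
    + (p $ jwx)\<^sup>2 * (d_bw \<psi> q + E * d_w (d_w f) (y, w)) + p $ jwx * d_bx \<psi> q
    + ((d_y f (y, w) + f (y, w) * d_w f (y, w)) * \<psi> q
      + f (y, w) * (d_by \<psi> q + f (y, w) * d_bw \<psi> q + \<psi> q * d_bE \<psi> q)
      - (\<psi> q / E + d_w f (y, w)) * (1 + f (y, w) * \<psi> q)
      + E * (d_y (d_y f) (y, w) + 2 * f (y, w) * d_y (d_w f) (y, w)
        + (f (y, w))\<^sup>2 * d_w (d_w f) (y, w)))"
proof -
  have pU: "p \<in> U" using p by (simp add: on_solution_jet_def)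
  have E: "E \<noteq> 0" using S(3) pU q by (auto simp: U_def)
  have yw: "yw h p = h (y, w)" for h using q by (simp add: yw_def lift_def)
  have lift: "lift c p = c q" for c using q by (simp add: lift_def)
  have pE: "p $ jE = E" using q by (simp add: base_point_def)
  have wy: "p $ jwy = f (y, w)" and Ey: "p $ jEy = \<psi> q"
    and wyy: "p $ jwyy = d_y f (y, w) + f (y, w) * d_w f (y, w)"
    using p invariant_w_eq[OF pU] invariant_E_eq[OF pU] Dy_invariant_w[OF pU]
    by (auto simp: on_solution_jet_def yw lift)
  have wxx: "p $ jwxx = - (1 + p $ jwx * p $ jEx + f (y, w) * \<psi> q) / E - p $ jwyy"
    using p E by (simp add: on_solution_jet_def equation_F_def pE wy Ey field_simps)
  show ?thesis
    unfolding pr2_equation_F[OF pU] yw lift wxx wy Ey pE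
    using E by (simp add: wyy field_simps power2_eq_square)
qed

lemma exists_solution_jet:
  assumes q: "q \<in> S"
  shows "\<exists>p. on_solution_jet p \<and> base_point p = q \<and> p $ jwx = a \<and> p $ jEx = b"
proof -
  obtain x y w E where qe: "q = (x, y, w, E)" by (metis prod_cases4)
  have E: "E \<noteq> 0" using S(3) q qe by simp
  define wyy where "wyy = d_y f (y, w) + f (y, w) * d_w f (y, w)"
  \<comment> \<open>Each dependent entry is solved from one side condition, \<open>jwxx\<close> from
    the equation itself. \<open>jExx\<close> occurs in none of them, because
    \<open>\<xi> = 0\<close>, and is set to 0.\<close>
  define p :: jet where "p = (\<chi> i. case i of
      jx \<Rightarrow> x | jy \<Rightarrow> y | jw \<Rightarrow> w | jE \<Rightarrow> E | jwx \<Rightarrow> a | jwy \<Rightarrow> f (y, w) | jEx \<Rightarrow> b | jEy \<Rightarrow> \<psi> q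
    | jwxx \<Rightarrow> - (1 + a * b + f (y, w) * \<psi> q) / E - wyy
    | jwxy \<Rightarrow> a * d_w f (y, w) | jwyy \<Rightarrow> wyy | jExx \<Rightarrow> 0
    | jExy \<Rightarrow> d_bx \<psi> q + a * d_bw \<psi> q + b * d_bE \<psi> q
    | jEyy \<Rightarrow> d_by \<psi> q + f (y, w) * d_bw \<psi> q + \<psi> q * d_bE \<psi> q)"
  have bp: "base_point p = q" by (simp add: p_def base_point_def qe)
  then have pU: "p \<in> U" using q by (simp add: U_def)
  have yw: "yw h p = h (y, w)" for h using bp qe by (simp add: yw_def lift_def)
  have lift: "lift c p = c q" for c using bp by (simp add: lift_def)
  have "on_solution_jet p"
    unfolding on_solution_jet_def invariant_w_eq[OF pU] invariant_E_eq[OF pU] Dx_invariant_w[OF pU]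
      Dy_invariant_w[OF pU] Dx_invariant_E[OF pU] Dy_invariant_E[OF pU] Dx_lift Dy_lift
      yw lift equation_F_def
    using pU E by (simp add: p_def wyy_def field_simps)
  then show ?thesis using bp by (intro exI[of _ p]) (simp add: p_def)
qed

lemma pr2_vanishes_iff:
  "(\<forall>p. on_solution_jet p \<longrightarrow> pr2 \<xi> (\<lambda>_. 1) \<phi> \<psi> equation_F p = 0) \<longleftrightarrow>
    (\<forall>q\<in>S. determining_equations q)"
proof (intro iffI ballI allI impI)
  fix p assume det: "\<forall>q\<in>S. determining_equations q" and p: "on_solution_jet p"
  obtain x y w E where q: "base_point p = (x, y, w, E)" by (metis prod_cases4)
  then have "determining_equations (x, y, w, E)"
    using det p by (auto simp: on_solution_jet_def U_def)
  note det = this[unfolded determining_equations_def prod.case]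
  have "d_bE \<psi> (x, y, w, E) - \<psi> (x, y, w, E) / E = 0"
    "d_bw \<psi> (x, y, w, E) + E * d_w (d_w f) (y, w) = 0"
    using det by simp_all
  with det show "pr2 \<xi> (\<lambda>_. 1) \<phi> \<psi> equation_F p = 0"
    unfolding pr2_on_solution_jet[OF p q refl] by (elim conjE) (simp only: mult_zero_right add_0)
next
  fix q assume pr2: "\<forall>p. on_solution_jet p \<longrightarrow> pr2 \<xi> (\<lambda>_. 1) \<phi> \<psi> equation_F p = 0" and q: "q \<in> S"
  obtain x y w E where qe: "q = (x, y, w, E)" by (metis prod_cases4)
  define c1 where "c1 = d_bE \<psi> q - \<psi> q / E"
  define c2 where "c2 = d_bw \<psi> q + E * d_w (d_w f) (y, w)"
  define c3 where "c3 = d_bx \<psi> q"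
  define c4 where "c4 = (d_y f (y, w) + f (y, w) * d_w f (y, w)) * \<psi> q
      + f (y, w) * (d_by \<psi> q + f (y, w) * d_bw \<psi> q + \<psi> q * d_bE \<psi> q)
      - (\<psi> q / E + d_w f (y, w)) * (1 + f (y, w) * \<psi> q)
      + E * (d_y (d_y f) (y, w) + 2 * f (y, w) * d_y (d_w f) (y, w)
        + (f (y, w))\<^sup>2 * d_w (d_w f) (y, w))"
  have poly: "a * b * c1 + a\<^sup>2 * c2 + a * c3 + c4 = 0" for a b
  proof -
    obtain p where p: "on_solution_jet p" "base_point p = q" "p $ jwx = a" "p $ jEx = b"
      using exists_solution_jet[OF q] by blast
    from pr2_on_solution_jet[OF p(1,2) qe] pr2 p show ?thesis
      by (simp add: c1_def c2_def c3_def c4_def)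
  qed
  \<comment> \<open>The point \<open>(0, 0)\<close> isolates \<open>c4\<close>, the points
    \<open>(1, 0)\<close> and \<open>(- 1, 0)\<close> separate \<open>c2\<close> from
    \<open>c3\<close>, and \<open>(1, 1)\<close> then yields \<open>c1\<close>.\<close>
  have "c4 = 0" "c1 = 0" "c2 = 0" "c3 = 0"
    using poly[of 0 0] poly[of 1 0] poly[of "- 1" 0] poly[of 1 1] by simp_all
  then show "determining_equations q"
    by (simp add: determining_equations_def qe c1_def c2_def c3_def c4_def)
qed

lemma nonclassical_generator_iff:
  assumes "\<xi> real_analytic_on S" "\<phi> real_analytic_on S" "\<psi> real_analytic_on S"
  shows "nonclassical_generator S \<xi> \<phi> \<psi> \<longleftrightarrow> (\<forall>q\<in>S. determining_equations q)"
proof -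
  have "nonclassical_generator S \<xi> \<phi> \<psi> \<longleftrightarrow>
      (\<forall>p. on_solution_jet p \<longrightarrow> pr2 \<xi> (\<lambda>_. 1) \<phi> \<psi> equation_F p = 0)"
    using assms S pr1_invariant_w pr1_invariant_E
    unfolding nonclassical_generator_def on_solution_jet_def U_def by fastforce
  then show ?thesis by (simp add: pr2_vanishes_iff)
qed

text \<open>With \<open>c = \<psi> / E\<close> the last equation reads \<open>K = c + f_w\<close>.
  Replacing \<open>E\<close> by \<open>r * E\<close> multiplies \<open>K\<close> by \<open>r\<close>
  and leaves the right side fixed, so both sides are 0.\<close>

lemma determining_equations_solution:
  assumes det: "\<forall>q\<in>S. determining_equations q" and q: "(x, y, w, E) \<in> S"
  shows "\<psi> (x, y, w, E) = - E * d_w f (y, w)"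
proof -
  from S(1) q obtain \<epsilon> where \<epsilon>: "\<epsilon> > 0" "ball (x, y, w, E) \<epsilon> \<subseteq> S"
    by (meson openE)
  define J where "J = cball E (\<epsilon> / 3)"
  \<comment> \<open>This keeps \<open>r * E\<close> within \<open>\<epsilon> / 3\<close> of
    \<open>E\<close>; a change of \<open>y\<close> by as much again still remains in the
    ball.\<close>
  define r where "r = 1 + min 1 (\<epsilon> / (3 * \<bar>E\<bar>))"
  have E: "E \<noteq> 0" using S(3)[OF q] .
  have r: "r > 1" using E \<epsilon>(1) by (simp add: r_def)
  have rE: "r * E \<in> J"
  proof -
    have "E - r * E = - ((r - 1) * E)"
      by (simp add: algebra_simps)
    then have "\<bar>E - r * E\<bar> = (r - 1) * \<bar>E\<bar>"
      using r by (simp add: abs_mult)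
    also have "\<dots> \<le> \<epsilon> / (3 * \<bar>E\<bar>) * \<bar>E\<bar>"
      by (intro mult_right_mono) (auto simp: r_def)
    finally show ?thesis using E by (simp add: J_def dist_real_def)
  qed
  have box: "(x, y', w, E') \<in> S" if "\<bar>y' - y\<bar> \<le> \<epsilon> / 3" "E' \<in> J" for y' E'
  proof -
    have "dist (x, y, w, E) (x, y', w, E') \<le> \<bar>y' - y\<bar> + \<bar>E' - E\<bar>"
      using sqrt_sum_squares_le_sum_abs[of "y' - y" "E' - E"]
      by (simp add: dist_Pair_Pair dist_real_def power2_commute)
    also have "\<dots> < \<epsilon>"
      using that \<epsilon>(1) by (simp add: J_def dist_real_def abs_minus_commute)
    finally show ?thesis using \<epsilon>(2) by auto
  qed
  \<comment> \<open>By the first determining equation \<open>\<psi> / E\<close> has derivative 0 in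
    \<open>E\<close> on the interval \<open>J\<close>, which avoids 0 because its points come from
    \<open>S\<close>.\<close>
  have homogeneous: "\<psi> (x, y', w, r * E) = r * \<psi> (x, y', w, E)" if y': "\<bar>y' - y\<bar> \<le> \<epsilon> / 3" for y'
  proof -
    have "((\<lambda>E. \<psi> (x, y', w, E) / E) has_real_derivative 0) (at E' within J)" if E': "E' \<in> J" for E'
    proof -
      note inS = box[OF y' E']
      have "((\<lambda>t. \<psi> ((x, y', w, E') + t *\<^sub>R (0, 0, 0, 1))) has_real_derivative
          d_bE \<psi> (x, y', w, E')) (at 0)"
        by (rule partially_differentiableD[OF \<psi>[OF inS]]) (simp add: base_Basis)
      moreover have "d_bE \<psi> (x, y', w, E') = \<psi> (x, y', w, E') / E'"
        using det inS by (auto simp: determining_equations_def)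
      ultimately have "((\<lambda>E. \<psi> (x, y', w, E)) has_real_derivative \<psi> (x, y', w, E') / E') (at E')"
        using DERIV_shift[of "\<lambda>E. \<psi> (x, y', w, E)" _ 0 E'] by (simp add: add.commute)
      from DERIV_divide[OF this DERIV_ident S(3)[OF inS]] S(3)[OF inS] show ?thesis
        by (simp add: has_field_derivative_at_within)
    qed
    then obtain c where c: "\<And>E'. E' \<in> J \<Longrightarrow> \<psi> (x, y', w, E') / E' = c"
      using has_field_derivative_zero_constant[of J "\<lambda>E. \<psi> (x, y', w, E) / E"]
      unfolding J_def by (auto simp: convex_cball)
    have "E \<in> J" using \<epsilon>(1) by (simp add: J_def)
    from c[OF this] c[OF rE] E r show ?thesis by (simp add: field_simps)
  qed
  have y0: "\<bar>y - y\<bar> \<le> \<epsilon> / 3" using \<epsilon>(1) by simp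
  have qr: "(x, y, w, r * E) \<in> S" by (rule box[OF y0 rE])
  have \<psi>r: "\<psi> (x, y, w, r * E) = r * \<psi> (x, y, w, E)" by (rule homogeneous[OF y0])
  \<comment> \<open>Homogeneity holds for all nearby \<open>y'\<close>, not only at
    \<open>y\<close>, so it may be differentiated in \<open>y\<close>.\<close>
  have dyr: "d_by \<psi> (x, y, w, r * E) = r * d_by \<psi> (x, y, w, E)"
  proof -
    have "((\<lambda>t. \<psi> ((x, y, w, E) + t *\<^sub>R (0, 1, 0, 0))) has_real_derivative d_by \<psi> (x, y, w, E)) (at 0)"
      by (rule partially_differentiableD[OF \<psi>[OF q]]) (simp add: base_Basis)
    from DERIV_cmult[OF this, of r]
    have "((\<lambda>t. r * \<psi> (x, y + t, w, E)) has_real_derivative r * d_by \<psi> (x, y, w, E)) (at 0)"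
      by simp
    moreover have "\<forall>\<^sub>F t in nhds 0. r * \<psi> (x, y + t, w, E) = \<psi> (x, y + t, w, r * E)"
      unfolding eventually_nhds_metric
      using \<epsilon>(1) homogeneous by (intro exI[of _ "\<epsilon> / 3"]) auto
    ultimately have "((\<lambda>t. \<psi> (x, y + t, w, r * E)) has_real_derivative r * d_by \<psi> (x, y, w, E)) (at 0)"
      by (subst DERIV_cong_ev[OF refl _ refl, symmetric])
    then show ?thesis by (intro partial_eqI) simp
  qed
  define P where "P = d_y f (y, w) + f (y, w) * d_w f (y, w)"
  \<comment> \<open>The terms linear in \<open>E\<close> after substituting
    \<open>\<psi>_E = c\<close>; the products \<open>f * \<psi> * \<psi>_E\<close> and
    \<open>(\<psi> / E) * f * \<psi>\<close> cancel.\<close>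
  define K where "K = P * \<psi> (x, y, w, E) + f (y, w) * (d_by \<psi> (x, y, w, E) - f (y, w) * (E * d_w (d_w f) (y, w)))
      - d_w f (y, w) * f (y, w) * \<psi> (x, y, w, E)
      + E * (d_y (d_y f) (y, w) + 2 * f (y, w) * d_y (d_w f) (y, w)
        + (f (y, w))\<^sup>2 * d_w (d_w f) (y, w))"
  define c where "c = \<psi> (x, y, w, E) / E"
  have E1: "K = c + d_w f (y, w)"
  proof -
    note d = bspec[OF det q, unfolded determining_equations_def prod.case]
    from d have d1: "d_bE \<psi> (x, y, w, E) = c"
      and d2: "d_bw \<psi> (x, y, w, E) = - E * d_w (d_w f) (y, w)"
      unfolding c_def by blast+
    from d show ?thesis
      unfolding d1 d2 c_def[symmetric] K_def P_def by (simp add: algebra_simps)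
  qed
  have E2: "r * K = c + d_w f (y, w)"
  proof -
    note d = bspec[OF det qr, unfolded determining_equations_def prod.case]
    have c: "r * \<psi> (x, y, w, E) / (r * E) = c"
      using r by (simp add: c_def)
    from d have d1: "d_bE \<psi> (x, y, w, r * E) = c"
      and d2: "d_bw \<psi> (x, y, w, r * E) = - (r * E) * d_w (d_w f) (y, w)"
      unfolding \<psi>r c by blast+
    from d show ?thesis
      unfolding d1 d2 \<psi>r c dyr K_def P_def by (simp add: algebra_simps)
  qed
  from E1 E2 have "(r - 1) * K = 0"
    by (simp add: algebra_simps)
  then have "c + d_w f (y, w) = 0"
    using r E1 by simp
  then show ?thesis using E by (simp add: c_def field_simps)
qed

lemma determining_equations_hold:
  assumes \<psi>eq: "\<And>x y w E. (x, y, w, E) \<in> S \<Longrightarrow> \<psi> (x, y, w, E) = - E * d_w f (y, w)"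
    and key: "\<And>q. q \<in> \<Omega> \<Longrightarrow> d_y (d_y f) q + f q * d_y (d_w f) q = d_y f q * d_w f q"
    and q: "q \<in> S"
  shows "determining_equations q"
proof -
  obtain x y w E where qe: "q = (x, y, w, E)" by (metis prod_cases4)
  have \<Omega>: "(y, w) \<in> \<Omega>" and E: "E \<noteq> 0" using S q qe by auto
  let ?m = "\<lambda>q::base. - snd (snd (snd q))" and ?d = "\<lambda>(x, y, w, E). d_w f (y, w)"
  have part: "partial b \<psi> q = partial b ?m q * ?d q + ?m q * partial b ?d q"
    and m: "partial b ?m q = - snd (snd (snd b))" if b: "b \<in> Basis" for b
  proof -
    have *: "((\<lambda>t. ?m (q + t *\<^sub>R b)) has_real_derivative - snd (snd (snd b))) (at 0)" for b
      by (auto intro!: derivative_eq_intros)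
    show "partial b ?m q = - snd (snd (snd b))"
      by (rule partial_eqI[OF *])
    have "partial b \<psi> q = partial b (\<lambda>q. ?m q * ?d q) q"
      using S(1) q by (rule partial_cong) (auto simp: \<psi>eq)
    also have "\<dots> = partial b ?m q * ?d q + ?m q * partial b ?d q"
      using partially_differentiableI[OF *] partially_differentiable_yw[OF f(3)[OF \<Omega>]] b
      unfolding qe by (intro partial_mult)
    finally show "partial b \<psi> q = partial b ?m q * ?d q + ?m q * partial b ?d q" .
  qed
  have "d_bE \<psi> q = - d_w f (y, w)" "d_bw \<psi> q = - E * d_w (d_w f) (y, w)" "d_bx \<psi> q = 0"
    "d_by \<psi> q = - E * d_y (d_w f) (y, w)"
    by (simp_all add: part m base_Basis d_by_yw d_bw_yw d_bx_yw d_bE_yw) (simp_all add: qe)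
  moreover have "\<psi> q = - E * d_w f (y, w)" using \<psi>eq q qe by simp
  moreover have "E * (d_y (d_y f) (y, w) + f (y, w) * d_y (d_w f) (y, w)) =
      E * (d_y f (y, w) * d_w f (y, w))"
    using key[OF \<Omega>] by simp
  ultimately show ?thesis
    using E by (simp add: determining_equations_def qe algebra_simps power2_eq_square)
qed

end

text \<open>With \<open>f = - g\<^sub>y / g\<^sub>w\<close> the equation for \<open>g\<close> reads \<open>f g\<^sub>w = - (y + \<alpha>(g))\<close>. Its \<open>y\<close>-derivative
  collapses to \<open>f\<^sub>y g\<^sub>w = - 1\<close>, and differentiating this again gives the claim.\<close>

lemma flow_identity:
  assumes \<Omega>: "open \<Omega>"
    and g: "\<And>q. q \<in> \<Omega> \<Longrightarrow> partially_differentiable g q"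
      "\<And>q. q \<in> \<Omega> \<Longrightarrow> partially_differentiable (d_w g) q"
      "\<And>q. q \<in> \<Omega> \<Longrightarrow> d_y (d_w g) q = d_w (d_y g) q"
      "\<And>q. q \<in> \<Omega> \<Longrightarrow> d_w g q \<noteq> 0"
    and \<alpha>: "\<And>q. q \<in> \<Omega> \<Longrightarrow> (\<alpha> has_real_derivative \<alpha>' (g q)) (at (g q))"
    and eq: "\<And>y w. (y, w) \<in> \<Omega> \<Longrightarrow> d_y g (y, w) = y + \<alpha> (g (y, w))"
    and f_def: "f = (\<lambda>q. - (d_y g q / d_w g q))"
    and f: "\<And>q. q \<in> \<Omega> \<Longrightarrow> partially_differentiable f q"
      "\<And>q. q \<in> \<Omega> \<Longrightarrow> partially_differentiable (d_y f) q"
      "\<And>q. q \<in> \<Omega> \<Longrightarrow> d_w (d_y f) q = d_y (d_w f) q"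
    and q: "q \<in> \<Omega>"
  shows "d_y (d_y f) q + f q * d_y (d_w f) q = d_y f q * d_w f q"
proof -
  have B: "(1, 0) \<in> (Basis :: (real \<times> real) set)" "(0, 1) \<in> (Basis :: (real \<times> real) set)"
    by (auto simp: Basis_prod_def)
  have gy: "((\<lambda>t. (fst q + t * fst b) + \<alpha> (g (q + t *\<^sub>R b))) has_real_derivative
      fst b + \<alpha>' (g q) * partial b g q) (at 0)" if "b \<in> Basis" "q \<in> \<Omega>" for b q
  proof -
    have "((\<lambda>t. \<alpha> (g (q + t *\<^sub>R b))) has_real_derivative \<alpha>' (g q) * partial b g q) (at 0)"
      using DERIV_chain2[of \<alpha> _ "\<lambda>t. g (q + t *\<^sub>R b)" 0] \<alpha>[OF that(2)]
        partially_differentiableD[OF g(1)[OF that(2)] that(1)] by auto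
    then show ?thesis
      by (intro DERIV_add) (auto intro!: derivative_eq_intros)
  qed
  have m: "partial b (\<lambda>q. fst q + \<alpha> (g q)) q = fst b + \<alpha>' (g q) * partial b g q"
    and m_diff: "partially_differentiable (\<lambda>q. fst q + \<alpha> (g q)) q"
    if "b \<in> Basis" "q \<in> \<Omega>" for b q
  proof -
    have *: "((\<lambda>t. fst (q + t *\<^sub>R b) + \<alpha> (g (q + t *\<^sub>R b))) has_real_derivative
        fst b + \<alpha>' (g q) * partial b g q) (at 0)" if "b \<in> Basis" for b
      using gy[OF that \<open>q \<in> \<Omega>\<close>] by simp
    show "partial b (\<lambda>q. fst q + \<alpha> (g q)) q = fst b + \<alpha>' (g q) * partial b g q"
      by (rule partial_eqI[OF *[OF that(1)]])
    show "partially_differentiable (\<lambda>q. fst q + \<alpha> (g q)) q"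
      by (rule partially_differentiableI[OF *])
  qed
  have fg: "f q * d_w g q = - (fst q + \<alpha> (g q))" if "q \<in> \<Omega>" for q
    using eq[of "fst q" "snd q"] g(4)[of q] that by (simp add: f_def)
  have dfg: "partial b f q * d_w g q + f q * partial b (d_w g) q = - (fst b + \<alpha>' (g q) * partial b g q)"
    if b: "b \<in> Basis" and q: "q \<in> \<Omega>" for b q
  proof -
    have "partial b (\<lambda>q. f q * d_w g q) q = partial b (\<lambda>q. - (fst q + \<alpha> (g q))) q"
      using \<Omega> q by (rule partial_cong) (rule fg)
    also have "\<dots> = - (fst b + \<alpha>' (g q) * partial b g q)"
      using partial_minus[OF m_diff[OF b q] b] m[OF b q] by simp
    finally show ?thesis
      by (simp add: partial_mult f(1) g(2) b q)
  qed
  have gyw: "d_y (d_w g) q = \<alpha>' (g q) * d_w g q" if q: "q \<in> \<Omega>" for q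
  proof -
    have "d_w (d_y g) q = d_w (\<lambda>q. fst q + \<alpha> (g q)) q"
      using \<Omega> q by (rule partial_cong) (use eq in auto)
    then show ?thesis using m[OF B(2) q] g(3)[OF q] by simp
  qed
  \<comment> \<open>By \<open>gyw\<close>, \<open>f * g_yw = - \<alpha>'(g) * g_y\<close>. This
    cancels the chain rule term on the right, and only the derivative of the explicit
    \<open>y\<close> survives.\<close>
  have fy: "d_y f q * d_w g q = - 1" if q: "q \<in> \<Omega>" for q
  proof -
    have "d_y g q = - (f q * d_w g q)"
      using g(4)[OF q] by (simp add: f_def)
    then show ?thesis
      using dfg[OF B(1) q] gyw[OF q] by (simp add: algebra_simps)
  qed
  have dfy: "partial b (d_y f) q * d_w g q + d_y f q * partial b (d_w g) q = 0" if b: "b \<in> Basis" for b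
  proof -
    have "partial b (\<lambda>q. d_y f q * d_w g q) q = partial b (\<lambda>_. - 1) q"
      using \<Omega> q by (rule partial_cong) (rule fy)
    then show ?thesis
      by (simp add: partial_mult f(2) g(2) b q)
  qed
  \<comment> \<open>Each bracket vanishes: the first two are the derivatives of
    \<open>f_y * g_w = - 1\<close>, the third expresses the \<open>w\<close>-derivative of
    \<open>f * g_w = - g_y\<close>.\<close>
  have "(d_y (d_y f) q + f q * d_y (d_w f) q - d_y f q * d_w f q) * d_w g q =
      (d_y (d_y f) q * d_w g q + d_y f q * d_y (d_w g) q)
      + f q * (d_w (d_y f) q * d_w g q + d_y f q * d_w (d_w g) q)
      - d_y f q * (d_w f q * d_w g q + f q * d_w (d_w g) q + d_y (d_w g) q)"
    using f(3)[OF q] by (simp add: algebra_simps)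
  also have "\<dots> = 0"
    using dfy[OF B(1)] dfy[OF B(2)] dfg[OF B(2) q] gyw[OF q] by simp
  finally show ?thesis using g(4)[OF q] by simp
qed

section \<open>The generator for \<open>g\<^sub>y = y + \<alpha>(g)\<close>\<close>

lemma real_analytic_imp_partially_differentiable:
  "f real_analytic_on S \<Longrightarrow> p \<in> S \<Longrightarrow> partially_differentiable f p"
  by (simp add: partially_differentiable_def real_analytic_on_has_partial)

lemma real_analytic_on_DERIV:
  fixes f :: "real \<Rightarrow> real"
  assumes "f real_analytic_on S" "x \<in> S"
  shows "(f has_real_derivative partial 1 f x) (at x)"
  using real_analytic_on_has_partial[OF assms, of 1] DERIV_shift[of f "partial 1 f x" 0 x]
  by (simp add: add.commute)

lemma real_analytic_on_yw:
  assumes "h real_analytic_on \<Omega>" "\<And>x y w E. (x, y, w, E) \<in> S \<Longrightarrow> (y, w) \<in> \<Omega>"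
  shows "(\<lambda>(x, y, w, E). h (y, w)) real_analytic_on (S :: base set)"
proof -
  define \<iota> :: "real \<times> real \<Rightarrow> base" where "\<iota> = (\<lambda>(a, b). (0, a, b, 0))"
  have "(\<lambda>q. h (fst (snd q), fst (snd (snd q)))) real_analytic_on S"
  proof (rule real_analytic_on_pullback[OF assms(1), where \<iota> = \<iota>])
    show "(\<lambda>q. (fst (snd q), fst (snd (snd q)))) ` S \<subseteq> \<Omega>"
      using assms(2) by auto
    show "inj_on \<iota> Basis" by (auto simp: \<iota>_def inj_on_def)
    show "\<iota> ` Basis \<subseteq> Basis"
      unfolding base_Basis by (auto simp: \<iota>_def Basis_prod_def)
    show "(fst (snd q), fst (snd (snd q))) \<bullet> b = q \<bullet> \<iota> b" for q :: base and b
      by (cases q, cases b) (simp add: \<iota>_def)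
  qed
  then show ?thesis by (simp add: case_prod_beta')
qed

theorem proposition5:
  fixes \<alpha> :: "real \<Rightarrow> real" and g :: "real \<times> real \<Rightarrow> real"
    and A :: "real \<times> real \<Rightarrow> real" and G :: "real \<times> real \<times> real \<Rightarrow> real"
    and I :: "real set" and \<Omega> :: "(real \<times> real) set" and S :: "base set"
  assumes "open I" and "\<alpha> real_analytic_on I"
    and "open \<Omega>" and "g real_analytic_on \<Omega>" and "g ` \<Omega> \<subseteq> I"
    and "\<forall>(y, w)\<in>\<Omega>. d_w g (y, w) \<noteq> 0"
    and "\<forall>(y, w)\<in>\<Omega>. d_y g (y, w) = y + \<alpha> (g (y, w))"
    and "open S" and "\<forall>(x, y, w, E)\<in>S. (y, w) \<in> \<Omega> \<and> E \<noteq> 0"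
    and "\<forall>(x, y, w, E)\<in>S. A (x, y) = 0"
    and "\<forall>(x, y, w, E)\<in>S. G (x, y, w) = - (d_y g (y, w) / d_w g (y, w))"
  defines "\<xi>\<^sub>0 \<equiv> \<lambda>(x, y, w, E). 0"
    and "\<phi>\<^sub>0 \<equiv> \<lambda>(x, y, w, E). - (d_y g (y, w) / d_w g (y, w))"
    and "\<psi>\<^sub>0 \<equiv> \<lambda>(x, y, w, E). E * d_w (\<lambda>q. d_y g q / d_w g q) (y, w)"
  shows "nonclassical_generator S \<xi>\<^sub>0 \<phi>\<^sub>0 \<psi>\<^sub>0 \<and>
    (\<forall>\<xi> \<phi> \<psi>. nonclassical_generator S \<xi> \<phi> \<psi> \<and>
        (\<forall>(x, y, w, E)\<in>S. \<xi> (x, y, w, E) = A (x, y) \<and> \<phi> (x, y, w, E) = G (x, y, w)) \<longrightarrow>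
        (\<forall>p\<in>S. \<xi> p = \<xi>\<^sub>0 p \<and> \<phi> p = \<phi>\<^sub>0 p \<and> \<psi> p = \<psi>\<^sub>0 p))"
proof -
  define f where "f = (\<lambda>q. - (d_y g q / d_w g q))"
  have B: "(1, 0) \<in> (Basis :: (real \<times> real) set)" "(0, 1) \<in> (Basis :: (real \<times> real) set)"
    by (auto simp: Basis_prod_def)
  have \<Omega>: "open \<Omega>" by fact
  have g: "g real_analytic_on \<Omega>" by fact
  note dg = real_analytic_on_partial[OF g B(1)] real_analytic_on_partial[OF g B(2)]
  have gw: "d_w g q \<noteq> 0" if "q \<in> \<Omega>" for q
    using assms(6) that by (cases q) auto
  have S\<Omega>: "(y, w) \<in> \<Omega>" "E \<noteq> 0" if "(x, y, w, E) \<in> S" for x y w E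
    using assms(9) that by auto
  have h: "(\<lambda>q. d_y g q / d_w g q) real_analytic_on \<Omega>"
    by (rule real_analytic_on_divide[OF dg gw])
  have f: "f real_analytic_on \<Omega>"
    using real_analytic_on_mult[OF real_analytic_on_const[of "- 1"] h] by (simp add: f_def)
  note df = real_analytic_on_partial[OF f B(1)] real_analytic_on_partial[OF f B(2)]
  have key: "d_y (d_y f) q + f q * d_y (d_w f) q = d_y f q * d_w f q" if "q \<in> \<Omega>" for q
  proof (rule flow_identity[OF \<Omega> _ _ _ gw _ _ f_def, where \<alpha>' = "partial 1 \<alpha>"])
    show "(\<alpha> has_real_derivative partial 1 \<alpha> (g q)) (at (g q))" if "q \<in> \<Omega>" for q
      using real_analytic_on_DERIV[OF assms(2)] assms(5) that by blast
    show "d_y g (y, w) = y + \<alpha> (g (y, w))" if "(y, w) \<in> \<Omega>" for y w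
      using assms(7) that by auto
  qed (use that B in \<open>auto intro: real_analytic_imp_partially_differentiable
      g f dg df real_analytic_on_partial_commute\<close>)
  have reduced: "reduced_generator S \<Omega> f \<xi> \<phi> \<psi>"
    if "\<And>q. q \<in> S \<Longrightarrow> \<xi> q = 0" "\<And>x y w E. (x, y, w, E) \<in> S \<Longrightarrow> \<phi> (x, y, w, E) = f (y, w)"
      "\<psi> real_analytic_on S" for \<xi> \<phi> \<psi>
  proof
    show "partially_differentiable \<psi> q" if "q \<in> S" for q
      by (rule real_analytic_imp_partially_differentiable) fact+
  qed (use \<open>open S\<close> S\<Omega> that B in \<open>auto intro: real_analytic_imp_partially_differentiable
      f df real_analytic_on_partial_commute[OF f]\<close>)
  \<comment> \<open>\<open>f\<close> includes the minus sign of \<open>\<phi>\<^sub>0\<close>,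
    whereas \<open>\<psi>\<^sub>0\<close> is written with the bare quotient.\<close>
  have dh: "d_w (\<lambda>q. d_y g q / d_w g q) q = - d_w f q" if "q \<in> \<Omega>" for q
    using partial_minus[OF real_analytic_imp_partially_differentiable[OF f that] B(2)]
    by (simp add: f_def)
  have \<psi>\<^sub>0: "\<psi>\<^sub>0 (x, y, w, E) = - E * d_w f (y, w)" if "(x, y, w, E) \<in> S" for x y w E
    using dh S\<Omega>(1)[OF that] by (simp add: \<psi>\<^sub>0_def)
  have \<phi>\<^sub>0: "\<phi>\<^sub>0 = (\<lambda>(x, y, w, E). f (y, w))"
    by (simp add: \<phi>\<^sub>0_def f_def)
  have \<phi>\<^sub>0_analytic: "\<phi>\<^sub>0 real_analytic_on S"
    unfolding \<phi>\<^sub>0 using f S\<Omega>(1) by (rule real_analytic_on_yw)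
  have \<xi>\<^sub>0_analytic: "\<xi>\<^sub>0 real_analytic_on S"
    unfolding \<xi>\<^sub>0_def by (simp add: real_analytic_on_const case_prod_beta')
  have \<psi>\<^sub>0_analytic: "\<psi>\<^sub>0 real_analytic_on S"
  proof -
    have "(\<lambda>q. (q \<bullet> (0, 0, 0, 1)) * (\<lambda>(x, y, w, E). d_w (\<lambda>q. d_y g q / d_w g q) (y, w)) q)
        real_analytic_on S"
      by (intro real_analytic_on_mult real_analytic_on_coord
          real_analytic_on_yw[OF real_analytic_on_partial[OF h B(2)]])
        (auto simp: base_Basis S\<Omega>)
    also have "(\<lambda>q. (q \<bullet> (0, 0, 0, 1)) * (\<lambda>(x, y, w, E). d_w (\<lambda>q. d_y g q / d_w g q) (y, w)) q) = \<psi>\<^sub>0"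
      by (auto simp: \<psi>\<^sub>0_def fun_eq_iff)
    finally show ?thesis .
  qed
  have "nonclassical_generator S \<xi>\<^sub>0 \<phi>\<^sub>0 \<psi>\<^sub>0"
  proof -
    interpret reduced_generator S \<Omega> f \<xi>\<^sub>0 \<phi>\<^sub>0 \<psi>\<^sub>0
      by (rule reduced) (auto simp: \<xi>\<^sub>0_def \<phi>\<^sub>0 \<psi>\<^sub>0_analytic)
    show ?thesis
      using nonclassical_generator_iff[OF \<xi>\<^sub>0_analytic \<phi>\<^sub>0_analytic \<psi>\<^sub>0_analytic]
        determining_equations_hold[OF \<psi>\<^sub>0 key] by blast
  qed
  moreover have "\<xi> p = \<xi>\<^sub>0 p \<and> \<phi> p = \<phi>\<^sub>0 p \<and> \<psi> p = \<psi>\<^sub>0 p"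
    if gen: "nonclassical_generator S \<xi> \<phi> \<psi>"
      and \<xi>\<phi>: "\<forall>(x, y, w, E)\<in>S. \<xi> (x, y, w, E) = A (x, y) \<and> \<phi> (x, y, w, E) = G (x, y, w)"
      and p: "p \<in> S" for \<xi> \<phi> \<psi> p
  proof -
    have \<xi>: "\<xi> (x, y, w, E) = 0" and \<phi>: "\<phi> (x, y, w, E) = f (y, w)" if "(x, y, w, E) \<in> S" for x y w E
      using \<xi>\<phi> assms(10,11) that by (fastforce simp: f_def)+
    have analytic: "\<xi> real_analytic_on S" "\<phi> real_analytic_on S" "\<psi> real_analytic_on S"
      using gen by (simp_all add: nonclassical_generator_def)
    interpret reduced_generator S \<Omega> f \<xi> \<phi> \<psi>
      by (rule reduced) (use \<xi> \<phi> analytic in auto)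
    have "\<forall>q\<in>S. determining_equations q"
      using gen nonclassical_generator_iff[OF analytic] by simp
    note sol = determining_equations_solution[OF this]
    show ?thesis
      using p sol \<xi> \<phi> \<psi>\<^sub>0 by (cases p) (auto simp: \<xi>\<^sub>0_def \<phi>\<^sub>0)
  qed
  ultimately show ?thesis by blast
qed

end
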